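(* There exists a process $\{X_t,t\in\mathbb{R}\}$ which is a forward Brownian motion and a backward Brownian motion but is not a two-sided Brownian motion.
   Context: Standard Brownian motion starts at $0$ at time $0$. A random time is a real-valued random variable (not necessarily a stopping time). Forward Brownian motion (FBM): a process $\{X_t,t\in\mathbb{R}\}$ for which there exist random times $S_n$, $n\in\{0,-1,-2,\dots\}$, such that $\lim_{n\to-\infty}S_n=-\infty$ a.s. and for every $n$ the process $\{X_{S_n+t}-X_{S_n},t\ge0\}$ is standard Brownian motion on $[0,\infty)$. Backward Brownian motion (BBM): a process $\{X_t,t\in\mathbb{R}\}$ such that $\{X_{-t},t\in\mathbb{R}\}$ is an FBM. Two-sided Brownian motion (2BM): a process $\{X_t,t\in\mathbb{R}\}$ for which there exists a random time $S$ such that $\{X_{S+t}-X_S,t\ge0\}$ and $\{X_{S-t}-X_S,t\ge0\}$ are independent standard Brownian motions. *)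

theory Defs
  imports "HOL-Probability.Probability"
begin

context prob_space
begin

definition stochastic_process :: "(real \<Rightarrow> 'a \<Rightarrow> real) \<Rightarrow> bool" where
  "stochastic_process X \<longleftrightarrow> (\<forall>t. random_variable borel (X t))"

text \<open>Only the values \<open>B t\<close> with \<open>t \<ge> 0\<close> matter. The last parameter of
  \<open>normal_density\<close> is the standard deviation, not the variance.\<close>

definition standard_BM :: "(real \<Rightarrow> 'a \<Rightarrow> real) \<Rightarrow> bool" where
  "standard_BM B \<longleftrightarrow>
     (\<forall>t\<ge>0. random_variable borel (B t)) \<and>
     (AE \<omega> in M. B 0 \<omega> = 0) \<and>
     (\<forall>s\<ge>0. \<forall>t>s. distributed M lborel (\<lambda>\<omega>. B t \<omega> - B s \<omega>) (normal_density 0 (sqrt (t - s)))) \<and>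
     (\<forall>(n::nat) t. 0 \<le> t 0 \<longrightarrow> mono_on {..n} t \<longrightarrow>
        indep_vars (\<lambda>_. borel) (\<lambda>i \<omega>. B (t (Suc i)) \<omega> - B (t i) \<omega>) {..<n}) \<and>
     (AE \<omega> in M. continuous_on {0..} (\<lambda>t. B t \<omega>))"

text \<open>Independence of two processes indexed by the nonnegative reals: independence of the
  associated random elements of the product space.\<close>

definition indep_processes :: "(real \<Rightarrow> 'a \<Rightarrow> real) \<Rightarrow> (real \<Rightarrow> 'a \<Rightarrow> real) \<Rightarrow> bool" where
  "indep_processes Y Z \<longleftrightarrow>
     indep_var (Pi\<^sub>M {0..} (\<lambda>_. borel)) (\<lambda>\<omega>. \<lambda>t\<in>{0..}. Y t \<omega>)
               (Pi\<^sub>M {0..} (\<lambda>_. borel)) (\<lambda>\<omega>. \<lambda>t\<in>{0..}. Z t \<omega>)"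

text \<open>No continuity of \<open>X\<close> is required below; in each case almost sure continuity on the whole
  line follows from that of the Brownian motions involved.\<close>

definition forward_BM :: "(real \<Rightarrow> 'a \<Rightarrow> real) \<Rightarrow> bool" where
  "forward_BM X \<longleftrightarrow> stochastic_process X \<and>
     (\<exists>S :: int \<Rightarrow> 'a \<Rightarrow> real.
        (\<forall>n\<le>0. random_variable borel (S n)) \<and>
        (AE \<omega> in M. filterlim (\<lambda>n. S n \<omega>) at_bot at_bot) \<and>
        (\<forall>n\<le>0. standard_BM (\<lambda>t \<omega>. X (S n \<omega> + t) \<omega> - X (S n \<omega>) \<omega>)))"

definition backward_BM :: "(real \<Rightarrow> 'a \<Rightarrow> real) \<Rightarrow> bool" where
  "backward_BM X \<longleftrightarrow> forward_BM (\<lambda>t. X (- t))"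

definition two_sided_BM :: "(real \<Rightarrow> 'a \<Rightarrow> real) \<Rightarrow> bool" where
  "two_sided_BM X \<longleftrightarrow> stochastic_process X \<and>
     (\<exists>S. random_variable borel S \<and>
        standard_BM (\<lambda>t \<omega>. X (S \<omega> + t) \<omega> - X (S \<omega>) \<omega>) \<and>
        standard_BM (\<lambda>t \<omega>. X (S \<omega> - t) \<omega> - X (S \<omega>) \<omega>) \<and>
        indep_processes (\<lambda>t \<omega>. X (S \<omega> + t) \<omega> - X (S \<omega>) \<omega>)
                        (\<lambda>t \<omega>. X (S \<omega> - t) \<omega> - X (S \<omega>) \<omega>))"

end

end

theory Submission
  imports Defs
begin

text \<open>
  Cut the line into independent Brownian pieces of unit length (``letters''). Words \<open>V n\<close> of
  deterministic lengths \<open>len n\<close> are built inductively from fresh words \<open>U\<close>, \<open>D\<close>, \<open>U'\<close> of equal length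
  \<open>blk n\<close>, much larger than \<open>len n\<close>: \<open>V (n + 1)\<close> is \<open>U D (V n) U'\<close> if the increments of the
  Brownian path over \<open>U\<close> and \<open>U'\<close> have the same sign, and \<open>U (V n) D U'\<close> otherwise. Each \<open>V (n + 1)\<close>
  extends \<open>V n\<close> to both sides, which yields a path on the whole line.

  Both orders turn i.i.d. letters into i.i.d. letters, and the rule that selects the order is a
  function of \<open>U\<close> and \<open>U'\<close> alone, so \<open>V (n + 1)\<close> has i.i.d. letters. Seen from the left end of \<open>V n\<close>,
  the word \<open>U\<close> is invisible and makes the selection an independent coin, so the letters to the right
  are i.i.d.; the same holds from the right end with \<open>U'\<close> in place of \<open>U\<close>. Hence the path is a
  forward and a backward Brownian motion.

  At every scale \<open>n\<close>, some position close to the origin satisfies one of two sign relations between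
  distant increments of the path. As \<open>blk n\<close> dominates \<open>len n\<close>, moving the position hardly changes
  these increments, so for a two-sided Brownian motion both relations fail for all
  nearby positions simultaneously, with a probability bounded away from \<open>0\<close>.
\<close>

section \<open>Gaussian noise\<close>

text \<open>The bit that selects the order has to be hidden from each side of \<open>V n\<close>
  alone and still tie the two sides together. An independent coin would not do: the letters on both
  sides of the origin would be i.i.d. and the path would be two-sided Brownian from the origin. The
  agreement of two independent fair signs is independent of each sign but determined by the pair,
  which is why one sign is read on each side of \<open>V n\<close>. The spacer \<open>D\<close>
  makes the bit leave a trace: the distances of \<open>U\<close> and \<open>U'\<close> from
  \<open>V n\<close> depend on it, so a path seen from \<open>V n\<close> must satisfy the relation
  belonging to one of the two layouts.

  About a random time \<open>S\<close> nothing is known beyond measurability; in particular its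
  joint law with the words is out of reach. Only tightness of \<open>S\<close> is available. The
  words therefore have to grow so slowly compared with the standard deviation of the next block that
  every time within distance \<open>n\<close> of the origin serves equally well.

  Working with letters instead of paths turns all statements about the law of a rearrangement into
  statements about one infinite product of normal laws.\<close>

lemma std_normal_density_rotation:
  "std_normal_density ((u + v) / sqrt 2) * std_normal_density ((u - v) / sqrt 2)
     = std_normal_density u * std_normal_density v"
proof -
  have "- ((u + v) / sqrt 2)\<^sup>2 / 2 + - ((u - v) / sqrt 2)\<^sup>2 / 2 = - u\<^sup>2 / 2 + - v\<^sup>2 / 2"
    by (simp add: power_divide power2_eq_square field_simps)
  then show ?thesis
    unfolding std_normal_density_def by (simp add: mult_ac flip: exp_add)
qed

text \<open>The map is orthogonal, so it preserves the product density. The change of variables in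
  the plane is split into two affine substitutions in one variable each, with an exchange of
  integrals between them; their factors \<open>sqrt 2\<close> and \<open>1 / sqrt 2\<close>
  cancel.\<close>

lemma distr_rotation_std_normal:
  "distr (std_normal_distribution \<Otimes>\<^sub>M std_normal_distribution)
     (std_normal_distribution \<Otimes>\<^sub>M std_normal_distribution)
     (\<lambda>p. ((fst p + snd p) / sqrt 2, (fst p - snd p) / sqrt 2))
   = std_normal_distribution \<Otimes>\<^sub>M std_normal_distribution"
    (is "distr ?P ?P ?r = ?P")
proof (rule measure_eqI)
  interpret N: prob_space std_normal_distribution by (rule prob_space_normal_density) simp
  let ?n = "\<lambda>x. ennreal (std_normal_density x)"
  have sP: "sets ?P = sets (borel \<Otimes>\<^sub>M borel)" by (intro sets_pair_measure_cong) auto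
  have r[measurable]: "?r \<in> ?P \<rightarrow>\<^sub>M ?P"
    by (subst measurable_cong_sets[OF sP sP]) measurable
  have intP: "(\<integral>\<^sup>+p. f p \<partial>?P) = (\<integral>\<^sup>+x. \<integral>\<^sup>+z. f (x, z) * (?n x * ?n z) \<partial>lborel \<partial>lborel)"
    if f: "f \<in> borel_measurable (borel \<Otimes>\<^sub>M borel)" for f :: "real \<times> real \<Rightarrow> ennreal"
  proof -
    note [measurable] = f
    have "(\<integral>\<^sup>+p. f p \<partial>?P) = (\<integral>\<^sup>+x. \<integral>\<^sup>+z. f (x, z) \<partial>std_normal_distribution \<partial>std_normal_distribution)"
      using f by (intro N.nn_integral_fst[symmetric]) (simp add: measurable_cong_sets[OF sP refl])
    also have "\<dots> = (\<integral>\<^sup>+x. ?n x * (\<integral>\<^sup>+z. ?n z * f (x, z) \<partial>lborel) \<partial>lborel)"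
      by (subst nn_integral_density) (auto simp: nn_integral_density)
    also have "\<dots> = (\<integral>\<^sup>+x. \<integral>\<^sup>+z. f (x, z) * (?n x * ?n z) \<partial>lborel \<partial>lborel)"
      by (subst nn_integral_cmult[symmetric]) (auto simp: mult_ac)
    finally show ?thesis .
  qed
  show "sets (distr ?P ?P ?r) = sets ?P" by simp
  fix A assume "A \<in> sets (distr ?P ?P ?r)"
  then have A[measurable]: "A \<in> sets (borel \<Otimes>\<^sub>M borel)" and A': "A \<in> sets ?P" using sP by auto
  define f where "f = (indicator A :: _ \<Rightarrow> ennreal)"
  have f[measurable]: "f \<in> borel_measurable (borel \<Otimes>\<^sub>M borel)" unfolding f_def by simp
  have "emeasure (distr ?P ?P ?r) A = (\<integral>\<^sup>+p. f p \<partial>distr ?P ?P ?r)"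
    using A' by (simp add: f_def)
  also have "\<dots> = (\<integral>\<^sup>+p. f (?r p) \<partial>?P)"
    by (rule nn_integral_distr) (auto simp: measurable_cong_sets[OF sP refl])
  also have "\<dots> = (\<integral>\<^sup>+x. \<integral>\<^sup>+z. f ((x + z) / sqrt 2, (x - z) / sqrt 2) * (?n x * ?n z) \<partial>lborel \<partial>lborel)"
    by (subst intP) auto
  also have "\<dots> = (\<integral>\<^sup>+x. ennreal (sqrt 2) * (\<integral>\<^sup>+u. f (u, sqrt 2 * x - u) * (?n x * ?n (sqrt 2 * u - x)) \<partial>lborel) \<partial>lborel)"
  proof (intro nn_integral_cong)
    fix x :: real
    have "(\<integral>\<^sup>+z. f ((x + z) / sqrt 2, (x - z) / sqrt 2) * (?n x * ?n z) \<partial>lborel)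
      = ennreal \<bar>sqrt 2\<bar> * (\<integral>\<^sup>+u. f ((x + (- x + sqrt 2 * u)) / sqrt 2, (x - (- x + sqrt 2 * u)) / sqrt 2)
            * (?n x * ?n (- x + sqrt 2 * u)) \<partial>lborel)"
      by (rule nn_integral_real_affine) simp_all
    moreover have "(x - (- x + sqrt 2 * u)) / sqrt 2 = sqrt 2 * x - u" for u
      by (simp add: field_simps)
    ultimately show "(\<integral>\<^sup>+z. f ((x + z) / sqrt 2, (x - z) / sqrt 2) * (?n x * ?n z) \<partial>lborel)
      = ennreal (sqrt 2) * (\<integral>\<^sup>+u. f (u, sqrt 2 * x - u) * (?n x * ?n (sqrt 2 * u - x)) \<partial>lborel)"
      by simp
  qed
  also have "\<dots> = ennreal (sqrt 2) * (\<integral>\<^sup>+x. (\<integral>\<^sup>+u. f (u, sqrt 2 * x - u) * (?n x * ?n (sqrt 2 * u - x)) \<partial>lborel) \<partial>lborel)"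
    by (rule nn_integral_cmult) simp
  also have "\<dots> = ennreal (sqrt 2) * (\<integral>\<^sup>+u. (\<integral>\<^sup>+x. f (u, sqrt 2 * x - u) * (?n x * ?n (sqrt 2 * u - x)) \<partial>lborel) \<partial>lborel)"
    by (subst lborel_pair.Fubini') simp_all
  also have "\<dots> = ennreal (sqrt 2) * (\<integral>\<^sup>+u. ennreal (1 / sqrt 2) * (\<integral>\<^sup>+v. f (u, v) * (?n u * ?n v) \<partial>lborel) \<partial>lborel)"
  proof (intro arg_cong[where f="\<lambda>x. ennreal (sqrt 2) * x"] nn_integral_cong)
    fix u :: real
    have "(\<integral>\<^sup>+x. f (u, sqrt 2 * x - u) * (?n x * ?n (sqrt 2 * u - x)) \<partial>lborel)
      = ennreal \<bar>1 / sqrt 2\<bar> * (\<integral>\<^sup>+v. f (u, sqrt 2 * (u / sqrt 2 + 1 / sqrt 2 * v) - u)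
            * (?n (u / sqrt 2 + 1 / sqrt 2 * v) * ?n (sqrt 2 * u - (u / sqrt 2 + 1 / sqrt 2 * v))) \<partial>lborel)"
      by (rule nn_integral_real_affine) simp_all
    moreover have "sqrt 2 * (u / sqrt 2 + 1 / sqrt 2 * v) - u = v" for v
      by (simp add: field_simps)
    moreover have "u / sqrt 2 + 1 / sqrt 2 * v = (u + v) / sqrt 2" for v
      by (simp add: field_simps)
    moreover have "sqrt 2 * u - (u + v) / sqrt 2 = (u - v) / sqrt 2" for v
      by (simp add: field_simps)
    moreover have "?n ((u + v) / sqrt 2) * ?n ((u - v) / sqrt 2) = ?n u * ?n v" for v
      by (simp add: std_normal_density_rotation flip: ennreal_mult)
    ultimately show "(\<integral>\<^sup>+x. f (u, sqrt 2 * x - u) * (?n x * ?n (sqrt 2 * u - x)) \<partial>lborel)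
       = ennreal (1 / sqrt 2) * (\<integral>\<^sup>+v. f (u, v) * (?n u * ?n v) \<partial>lborel)"
      by simp
  qed
  also have "\<dots> = (\<integral>\<^sup>+u. (\<integral>\<^sup>+v. f (u, v) * (?n u * ?n v) \<partial>lborel) \<partial>lborel)"
    by (subst nn_integral_cmult) (auto simp: mult.assoc[symmetric] ennreal_mult[symmetric])
  also have "\<dots> = (\<integral>\<^sup>+p. f p \<partial>?P)"
    by (rule intP[symmetric]) simp
  also have "\<dots> = emeasure ?P A"
    using A' by (simp add: f_def)
  finally show "emeasure (distr ?P ?P ?r) A = emeasure ?P A" .
qed


section \<open>Families of independent standard normal variables\<close>

definition gauss_space :: "('i \<Rightarrow> real) measure" where
  "gauss_space = PiM UNIV (\<lambda>_. std_normal_distribution)"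

text \<open>Formulated as an equality of laws, so that noises compose:
  \<open>gauss_noise gauss_space f\<close> says that \<open>f\<close> carries the product law on its
  source indices to the one on its target indices.\<close>

definition gauss_noise :: "'a measure \<Rightarrow> ('a \<Rightarrow> 'i \<Rightarrow> real) \<Rightarrow> bool" where
  "gauss_noise M y \<longleftrightarrow> y \<in> M \<rightarrow>\<^sub>M gauss_space \<and> distr M gauss_space y = gauss_space"

lemma prob_space_std_normal: "prob_space std_normal_distribution"
  by (rule prob_space_normal_density) simp

lemma prob_space_gauss: "prob_space gauss_space"
  unfolding gauss_space_def by (intro prob_space_PiM prob_space_std_normal)

lemma space_gauss[simp]: "space gauss_space = UNIV"
  by (simp add: gauss_space_def space_PiM)

lemma sets_gauss: "sets gauss_space = sets (PiM UNIV (\<lambda>_. borel))"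
  unfolding gauss_space_def by (intro sets_PiM_cong) auto

lemma measurable_gauss_iff:
  "y \<in> M \<rightarrow>\<^sub>M gauss_space \<longleftrightarrow> (\<forall>i. (\<lambda>\<omega>. y \<omega> i) \<in> borel_measurable M)"
proof
  assume "y \<in> M \<rightarrow>\<^sub>M gauss_space"
  then have "y \<in> M \<rightarrow>\<^sub>M PiM UNIV (\<lambda>_. borel)"
    by (simp add: measurable_cong_sets[OF refl sets_gauss])
  then show "\<forall>i. (\<lambda>\<omega>. y \<omega> i) \<in> borel_measurable M"
    by (auto intro!: measurable_compose[OF _ measurable_component_singleton])
next
  assume "\<forall>i. (\<lambda>\<omega>. y \<omega> i) \<in> borel_measurable M"
  then have "(\<lambda>\<omega> i. y \<omega> i) \<in> M \<rightarrow>\<^sub>M PiM UNIV (\<lambda>_. borel)"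
    by (intro measurable_abs_UNIV) auto
  then show "y \<in> M \<rightarrow>\<^sub>M gauss_space"
    by (simp add: measurable_cong_sets[OF refl sets_gauss])
qed

lemma measurable_gauss_coord[measurable]: "(\<lambda>y. y i) \<in> borel_measurable gauss_space"
  using measurable_gauss_iff[THEN iffD1, OF measurable_ident_sets[OF refl]] by (rule spec)

lemma sets_gauss_box:
  assumes "finite J" "\<And>i. i \<in> J \<Longrightarrow> A i \<in> sets borel"
  shows "{y. \<forall>i\<in>J. y i \<in> A i} \<in> sets gauss_space"
proof -
  have "{y \<in> space gauss_space. y i \<in> A i} \<in> sets gauss_space" if "i \<in> J" for i
    using measurable_sets[OF measurable_gauss_coord assms(2)[OF that], of i]
    by (simp add: vimage_def)
  then have "{y \<in> space gauss_space. \<forall>i\<in>J. y i \<in> A i} \<in> sets gauss_space"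
    using assms(1) by (intro sets.sets_Collect_finite_All) auto
  then show ?thesis by simp
qed

lemma emeasure_gauss_box:
  assumes "finite J" "\<And>i. i \<in> J \<Longrightarrow> A i \<in> sets borel"
  shows "emeasure gauss_space {y. \<forall>i\<in>J. y i \<in> A i} = (\<Prod>i\<in>J. emeasure std_normal_distribution (A i))"
proof -
  have "{y. \<forall>i\<in>J. y i \<in> A i} = prod_emb UNIV (\<lambda>_. std_normal_distribution) J (Pi\<^sub>E J A)"
    by (auto simp: prod_emb_def PiE_iff)
  then show ?thesis
    unfolding gauss_space_def using assms
    by (simp add: emeasure_PiM_emb prob_space_std_normal)
qed

lemma gauss_space_eqI:
  assumes "sets P = sets gauss_space"
    and "\<And>J A. finite J \<Longrightarrow> (\<And>i. i \<in> J \<Longrightarrow> A i \<in> sets borel) \<Longrightarrow>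
      emeasure P {y. \<forall>i\<in>J. y i \<in> A i} = (\<Prod>i\<in>J. emeasure std_normal_distribution (A i))"
  shows "P = gauss_space"
proof -
  have "gauss_space = P"
    unfolding gauss_space_def
  proof (rule measure_eqI_PiM_infinite)
    show "sets P = sets (PiM UNIV (\<lambda>_. std_normal_distribution))"
      using assms(1) by (simp add: gauss_space_def)
    show "finite_measure (PiM UNIV (\<lambda>_::'a. std_normal_distribution))"
      using prob_space_gauss[unfolded gauss_space_def] by (rule prob_space.finite_measure)
  next
    fix J :: "'a set" and A :: "'a \<Rightarrow> real set"
    assume J: "finite J" and A: "\<And>i. i \<in> J \<Longrightarrow> A i \<in> sets std_normal_distribution"
    have "{y. \<forall>i\<in>J. y i \<in> A i} = prod_emb UNIV (\<lambda>_. std_normal_distribution) J (Pi\<^sub>E J A)"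
      by (auto simp: prod_emb_def PiE_iff)
    then show "emeasure (PiM UNIV (\<lambda>_. std_normal_distribution))
        (prod_emb UNIV (\<lambda>_. std_normal_distribution) J (Pi\<^sub>E J A))
      = emeasure P (prod_emb UNIV (\<lambda>_. std_normal_distribution) J (Pi\<^sub>E J A))"
      using assms(2)[OF J, of A] emeasure_gauss_box[OF J, of A] A by (simp add: gauss_space_def)
  qed simp
  then show ?thesis ..
qed

lemma gauss_noiseI:
  fixes y :: "'a \<Rightarrow> 'i \<Rightarrow> real"
  assumes "\<And>i. (\<lambda>\<omega>. y \<omega> i) \<in> borel_measurable M"
    and "\<And>J A. finite J \<Longrightarrow> (\<And>i. i \<in> J \<Longrightarrow> A i \<in> sets borel) \<Longrightarrow>
      emeasure M {\<omega>\<in>space M. \<forall>i\<in>J. y \<omega> i \<in> A i} = (\<Prod>i\<in>J. emeasure std_normal_distribution (A i))"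
  shows "gauss_noise M y"
proof -
  have y: "y \<in> M \<rightarrow>\<^sub>M gauss_space" using assms(1) by (simp add: measurable_gauss_iff)
  moreover have "distr M gauss_space y = gauss_space"
  proof (rule gauss_space_eqI)
    fix J :: "'i set" and A :: "'i \<Rightarrow> real set"
    assume J: "finite J" and A: "\<And>i. i \<in> J \<Longrightarrow> A i \<in> sets borel"
    note * = sets_gauss_box[of J A, OF J A]
    show "emeasure (distr M gauss_space y) {y. \<forall>i\<in>J. y i \<in> A i} = (\<Prod>i\<in>J. emeasure std_normal_distribution (A i))"
      using assms(2)[of J A] J A by (subst emeasure_distr[OF y *]) (auto simp: vimage_def Int_def conj_commute)
  qed simp
  ultimately show ?thesis by (simp add: gauss_noise_def)
qed

lemma gauss_noise_box:
  assumes "gauss_noise M y" "finite J" "\<And>i. i \<in> J \<Longrightarrow> A i \<in> sets borel"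
  shows "emeasure M {\<omega>\<in>space M. \<forall>i\<in>J. y \<omega> i \<in> A i} = (\<Prod>i\<in>J. emeasure std_normal_distribution (A i))"
proof -
  have y: "y \<in> M \<rightarrow>\<^sub>M gauss_space" and d: "distr M gauss_space y = gauss_space"
    using assms(1) by (auto simp: gauss_noise_def)
  have "emeasure M {\<omega>\<in>space M. \<forall>i\<in>J. y \<omega> i \<in> A i} = emeasure (distr M gauss_space y) {y. \<forall>i\<in>J. y i \<in> A i}"
    by (subst emeasure_distr[OF y sets_gauss_box])
       (use assms in \<open>auto simp: vimage_def Int_def conj_commute\<close>)
  then show ?thesis
    using assms by (simp add: d emeasure_gauss_box)
qed

lemma gauss_noise_measurable: "gauss_noise M y \<Longrightarrow> (\<lambda>\<omega>. y \<omega> i) \<in> borel_measurable M"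
  by (simp add: gauss_noise_def measurable_gauss_iff)

lemma gauss_noise_comp:
  assumes "gauss_noise M y" "gauss_noise gauss_space f"
  shows "gauss_noise M (\<lambda>\<omega>. f (y \<omega>))"
proof -
  have "distr M gauss_space (f \<circ> y) = distr (distr M gauss_space y) gauss_space f"
    using assms by (intro distr_distr[symmetric]) (auto simp: gauss_noise_def)
  then show ?thesis
    using assms by (auto simp: gauss_noise_def comp_def intro: measurable_compose)
qed

lemma gauss_noise_reindex:
  assumes "inj \<sigma>"
  shows "gauss_noise gauss_space (\<lambda>y i. y (\<sigma> i))"
  using distr_PiM_reindex[of UNIV "\<lambda>_. std_normal_distribution" \<sigma> UNIV] assms
  by (simp add: gauss_noise_def measurable_gauss_iff)
     (simp add: gauss_space_def prob_space_std_normal restrict_UNIV)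

text \<open>The standard normal law is even. Sign changes serve twice: to toggle the selecting coin,
  and to reverse increments that are read from right to left.\<close>

lemma gauss_noise_sign:
  assumes s: "\<And>i. s i = 1 \<or> s i = (-1::real)"
  shows "gauss_noise gauss_space (\<lambda>y i. s i * y i)"
proof (rule gauss_noiseI)
  show "(\<lambda>y. s i * y i) \<in> borel_measurable gauss_space" for i by measurable
next
  fix J :: "'a set" and A :: "'a \<Rightarrow> real set"
  assume J: "finite J" and A: "\<And>i. i \<in> J \<Longrightarrow> A i \<in> sets borel"
  have inv: "(\<lambda>x. c * x) -` B \<in> sets borel"
    "emeasure std_normal_distribution ((\<lambda>x. c * x) -` B) = emeasure std_normal_distribution B"
    if "B \<in> sets borel" "c = 1 \<or> c = (-1::real)" for B c
  proof -
    show m: "(\<lambda>x. c * x) -` B \<in> sets borel"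
      using that(1) by (intro measurable_sets_borel[of "\<lambda>x. c * x"]) auto
    show "emeasure std_normal_distribution ((\<lambda>x. c * x) -` B) = emeasure std_normal_distribution B"
    proof (cases "c = 1")
      case False
      then have c: "c = -1" using that by auto
      have "emeasure std_normal_distribution B = (\<integral>\<^sup>+x. ennreal (std_normal_density x) * indicator B x \<partial>lborel)"
        using that by (subst emeasure_density) auto
      also have "\<dots> = ennreal \<bar>-1\<bar> * (\<integral>\<^sup>+x. ennreal (std_normal_density (0 + (-1) * x)) * indicator B (0 + (-1) * x) \<partial>lborel)"
        by (rule nn_integral_real_affine) (use that in auto)
      also have "\<dots> = (\<integral>\<^sup>+x. ennreal (std_normal_density x) * indicator ((\<lambda>x. c * x) -` B) x \<partial>lborel)"
        by (auto intro!: nn_integral_cong simp: c std_normal_density_def indicator_def)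
      also have "\<dots> = emeasure std_normal_distribution ((\<lambda>x. c * x) -` B)"
        using m by (subst emeasure_density) auto
      finally show ?thesis ..
    qed (simp add: vimage_def)
  qed
  have "emeasure gauss_space {y. \<forall>i\<in>J. y i \<in> (\<lambda>x. s i * x) -` A i}
    = (\<Prod>i\<in>J. emeasure std_normal_distribution ((\<lambda>x. s i * x) -` A i))"
    using A s J by (intro emeasure_gauss_box) (auto intro: inv)
  also have "\<dots> = (\<Prod>i\<in>J. emeasure std_normal_distribution (A i))"
    using A s by (intro prod.cong inv) auto
  finally show "emeasure gauss_space {y\<in>space gauss_space. \<forall>i\<in>J. s i * y i \<in> A i} = (\<Prod>i\<in>J. emeasure std_normal_distribution (A i))"
    by simp
qed


lemma gauss_noise_indep_vars:
  "prob_space.indep_vars gauss_space (\<lambda>_. std_normal_distribution) (\<lambda>i y. y i) UNIV"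
proof -
  interpret prob_space gauss_space by (rule prob_space_gauss)
  have m: "(\<lambda>y. y i) \<in> gauss_space \<rightarrow>\<^sub>M std_normal_distribution" for i :: 'a
    using measurable_gauss_coord[of i] by simp
  have 1: "distr gauss_space std_normal_distribution (\<lambda>y. y i) = std_normal_distribution" for i :: 'a
    unfolding gauss_space_def by (rule distr_PiM_component) (auto intro: prob_space_std_normal)
  show ?thesis
    by (subst indep_vars_iff_distr_eq_PiM)
       (use m in \<open>simp_all add: 1 restrict_UNIV\<close>, simp add: gauss_space_def distr_id2)
qed

text \<open>The pairs formed by \<open>f j\<close> and \<open>g j\<close> are disjoint, hence
  independent, and each is rotated by a map that preserves its law. An output \<open>k\<close> is
  one coordinate of one rotated pair: \<open>e k\<close> names the pair and \<open>c k\<close> the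
  coordinate. By the last assumption no coordinate is used twice.\<close>

lemma gauss_noise_refine:
  fixes f g :: "'j \<Rightarrow> 'i" and e :: "'k \<Rightarrow> 'j" and c :: "'k \<Rightarrow> bool"
  assumes f: "inj f" and g: "inj g" and fg: "\<And>i j. f i \<noteq> g j"
    and ce: "\<And>k l. e k = e l \<Longrightarrow> c k = c l \<Longrightarrow> k = l"
  shows "gauss_noise gauss_space
    (\<lambda>y k. if c k then (y (f (e k)) + y (g (e k))) / sqrt 2 else (y (f (e k)) - y (g (e k))) / sqrt 2)"
proof (rule gauss_noiseI)
  show "(\<lambda>y. if c k then (y (f (e k)) + y (g (e k))) / sqrt 2 else (y (f (e k)) - y (g (e k))) / sqrt 2)
    \<in> borel_measurable gauss_space" for k by measurable
next
  interpret prob_space gauss_space by (rule prob_space_gauss)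
  interpret N: prob_space std_normal_distribution by (rule prob_space_std_normal)
  let ?N = std_normal_distribution
  let ?P = "?N \<Otimes>\<^sub>M ?N"
  let ?r = "\<lambda>p. ((fst p + snd p) / sqrt 2, (fst p - snd p) / sqrt 2) :: real \<times> real"
  define Y where "Y = (\<lambda>j (y::'i \<Rightarrow> real). (y (f j), y (g j)))"
  have sP: "sets ?P = sets (borel \<Otimes>\<^sub>M borel)" by (intro sets_pair_measure_cong) auto
  have r: "?r \<in> ?P \<rightarrow>\<^sub>M ?P"
    by (subst measurable_cong_sets[OF sP sP]) measurable
  have coord: "(\<lambda>y. y i) \<in> gauss_space \<rightarrow>\<^sub>M ?N" for i :: 'i
    using measurable_gauss_coord[of i] by simp
  have Y: "Y j \<in> gauss_space \<rightarrow>\<^sub>M ?P" for j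
    unfolding Y_def by (intro measurable_Pair coord)
  have iY: "indep_vars (\<lambda>_. ?P) Y UNIV"
  proof -
    have "indep_vars (\<lambda>j. PiM {f j, g j} (\<lambda>_. ?N)) (\<lambda>j y. restrict (\<lambda>i. y i) {f j, g j}) UNIV"
    proof (intro indep_vars_restrict[OF gauss_noise_indep_vars])
      show "disjoint_family (\<lambda>j. {f j, g j})"
        using f g fg fg[symmetric] by (auto simp: disjoint_family_on_def inj_eq)
    qed simp
    then have "indep_vars (\<lambda>_. ?P) (\<lambda>j y. (\<lambda>p. (p (f j), p (g j))) (restrict (\<lambda>i. y i) {f j, g j})) UNIV"
      by (rule indep_vars_compose2) (intro measurable_Pair measurable_component_singleton; simp)
    then show ?thesis by (simp add: Y_def[abs_def])
  qed
  have dY: "distr gauss_space ?P (Y j) = ?P" for j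
  proof -
    have "indep_var ?N (\<lambda>y. y (f j)) ?N (\<lambda>y. y (g j))"
    proof -
      have "indep_var (PiM {f j} (\<lambda>_. ?N)) (\<lambda>y. restrict (\<lambda>i. y i) {f j}) (PiM {g j} (\<lambda>_. ?N)) (\<lambda>y. restrict (\<lambda>i. y i) {g j})"
        using fg by (intro indep_var_restrict[OF gauss_noise_indep_vars]) auto
      then have "indep_var ?N ((\<lambda>p. p (f j)) \<circ> (\<lambda>y. restrict (\<lambda>i. y i) {f j})) ?N ((\<lambda>p. p (g j)) \<circ> (\<lambda>y. restrict (\<lambda>i. y i) {g j}))"
        by (rule indep_var_compose) (intro measurable_component_singleton; simp)+
      then show ?thesis by (simp add: comp_def)
    qed
    then have "distr gauss_space ?N (\<lambda>y. y (f j)) \<Otimes>\<^sub>M distr gauss_space ?N (\<lambda>y. y (g j)) = distr gauss_space ?P (Y j)"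
      unfolding indep_var_distribution_eq Y_def by simp
    moreover have "distr gauss_space ?N (\<lambda>y. y i) = ?N" for i :: 'i
      unfolding gauss_space_def by (rule distr_PiM_component) (auto intro: prob_space_std_normal)
    ultimately show ?thesis by simp
  qed
  fix K :: "'k set" and A :: "'k \<Rightarrow> real set"
  assume K: "finite K" and A: "\<And>i. i \<in> K \<Longrightarrow> A i \<in> sets borel"
  define J where "J = e ` K"
  have J: "finite J" using K by (simp add: J_def)
  \<comment> \<open>By \<open>ce\<close> at most one index contributes to the intersection. If there
    is none, it is the whole line, of mass 1, matching the empty product.\<close>
  define T where "T j b = (\<Inter>k\<in>{k\<in>K. e k = j \<and> c k = b}. A k)" for j b
  have sT[measurable]: "T j b \<in> sets borel" for j b
  proof (cases "{k\<in>K. e k = j \<and> c k = b} = {}")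
    case False
    then show ?thesis unfolding T_def using K A by (intro sets.finite_INT) auto
  next
    case True
    then show ?thesis unfolding T_def by (simp only: True) simp
  qed
  define R where "R j = ?r -` (T j True \<times> T j False) \<inter> space ?P" for j
  have TT: "T j True \<times> T j False \<in> sets ?P" for j
    using sT by (intro pair_measureI) auto
  then have R: "R j \<in> sets ?P" for j
    unfolding R_def by (intro measurable_sets[OF r])
  have nT: "(\<Prod>k\<in>{k\<in>K. e k = j \<and> c k = b}. emeasure ?N (A k)) = emeasure ?N (T j b)" for j b
  proof (cases "{k\<in>K. e k = j \<and> c k = b} = {}")
    case True
    then show ?thesis unfolding T_def using N.emeasure_space_1 by (simp only: True) simp
  next
    case False
    then obtain k where "{k\<in>K. e k = j \<and> c k = b} = {k}" using ce by blast
    then show ?thesis by (simp add: T_def)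
  qed
  have "prob (\<Inter>j\<in>J. Y j -` R j \<inter> space gauss_space) = (\<Prod>j\<in>J. prob (Y j -` R j \<inter> space gauss_space))" if "J \<noteq> {}"
    using that J R by (intro indep_varsD[OF iY]) auto
  then have 1: "emeasure gauss_space (\<Inter>j\<in>J. Y j -` R j \<inter> space gauss_space) = (\<Prod>j\<in>J. emeasure gauss_space (Y j -` R j \<inter> space gauss_space))" if "J \<noteq> {}"
    using that by (simp add: emeasure_eq_measure prod_ennreal)
  have 2: "emeasure gauss_space (Y j -` R j \<inter> space gauss_space) = emeasure ?N (T j True) * emeasure ?N (T j False)" for j
  proof -
    have "emeasure gauss_space (Y j -` R j \<inter> space gauss_space) = emeasure ?P (R j)"
      using R[of j] by (subst emeasure_distr[OF Y, symmetric]) (auto simp: dY)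
    also have "\<dots> = emeasure (distr ?P ?P ?r) (T j True \<times> T j False)"
      unfolding R_def by (rule emeasure_distr[symmetric]) (use r TT in auto)
    also have "\<dots> = emeasure ?P (T j True \<times> T j False)"
      by (simp only: distr_rotation_std_normal)
    also have "\<dots> = emeasure ?N (T j True) * emeasure ?N (T j False)"
      using sT by (intro N.emeasure_pair_measure_Times) auto
    finally show ?thesis .
  qed
  have 3: "(\<Prod>j\<in>J. emeasure ?N (T j True) * emeasure ?N (T j False)) = (\<Prod>k\<in>K. emeasure ?N (A k))"
  proof -
    have "emeasure ?N (T j True) * emeasure ?N (T j False) = (\<Prod>k\<in>{k\<in>K. e k = j}. emeasure ?N (A k))" for j
    proof -
      have "{k\<in>K. e k = j} = {k\<in>K. e k = j \<and> c k = True} \<union> {k\<in>K. e k = j \<and> c k = False}" by auto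
      then show ?thesis
        unfolding nT[symmetric] using K by (simp only:) (subst prod.union_disjoint, auto)
    qed
    then show ?thesis
      using prod.group[OF K J, of e "\<lambda>k. emeasure ?N (A k)"] by (simp add: J_def)
  qed
  have 4: "{y\<in>space gauss_space. \<forall>k\<in>K. (if c k then (y (f (e k)) + y (g (e k))) / sqrt 2 else (y (f (e k)) - y (g (e k))) / sqrt 2) \<in> A k}
     = (\<Inter>j\<in>J. Y j -` R j \<inter> space gauss_space)" if "J \<noteq> {}"
    using that by (auto simp: J_def Y_def R_def T_def space_pair_measure) metis+
  show "emeasure gauss_space {y\<in>space gauss_space. \<forall>k\<in>K. (if c k then (y (f (e k)) + y (g (e k))) / sqrt 2 else (y (f (e k)) - y (g (e k))) / sqrt 2) \<in> A k}
     = (\<Prod>k\<in>K. emeasure ?N (A k))"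
  proof (cases "K = {}")
    case True
    then show ?thesis using emeasure_space_1 by simp
  next
    case False
    then have "J \<noteq> {}" by (simp add: J_def)
    then show ?thesis using 1 2 3 4 by simp
  qed
qed


section \<open>Consequences of being a noise, and mixtures of two noises\<close>

lemma gauss_noise_indep:
  assumes "prob_space M" "gauss_noise M y"
  shows "prob_space.indep_vars M (\<lambda>_. borel) (\<lambda>i \<omega>. y \<omega> i) UNIV"
    and "distributed M lborel (\<lambda>\<omega>. y \<omega> i) std_normal_density"
proof -
  interpret prob_space M by fact
  let ?N = std_normal_distribution
  have b: "(\<lambda>\<omega>. y \<omega> i) \<in> borel_measurable M" for i
    using assms(2) by (rule gauss_noise_measurable)
  then have m: "(\<lambda>\<omega>. y \<omega> i) \<in> M \<rightarrow>\<^sub>M ?N" for i by simp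
  have d: "distr M ?N (\<lambda>\<omega>. y \<omega> i) = ?N" for i
  proof (rule measure_eqI)
    fix A assume "A \<in> sets (distr M ?N (\<lambda>\<omega>. y \<omega> i))"
    then have A: "A \<in> sets borel" by simp
    then show "emeasure (distr M ?N (\<lambda>\<omega>. y \<omega> i)) A = emeasure ?N A"
      using gauss_noise_box[OF assms(2), of "{i}" "\<lambda>_. A"] m[of i]
      by (simp add: emeasure_distr vimage_def Int_def conj_commute)
  qed simp
  have "indep_vars (\<lambda>_. ?N) (\<lambda>i \<omega>. y \<omega> i) UNIV"
    by (subst indep_vars_iff_distr_eq_PiM)
       (use m assms(2) in \<open>simp_all add: d restrict_UNIV gauss_noise_def gauss_space_def\<close>)
  then show "indep_vars (\<lambda>_. borel) (\<lambda>i \<omega>. y \<omega> i) UNIV"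
    by (rule indep_vars_compose2[where Y="\<lambda>_ x. x"]) simp
  have "distr M lborel (\<lambda>\<omega>. y \<omega> i) = distr M ?N (\<lambda>\<omega>. y \<omega> i)"
    by (rule distr_cong) auto
  then show "distributed M lborel (\<lambda>\<omega>. y \<omega> i) std_normal_density"
    unfolding distributed_def using b by (simp add: d)
qed

lemma gauss_noise_emeasure:
  "gauss_noise M y \<Longrightarrow> A \<in> sets gauss_space \<Longrightarrow> emeasure M {\<omega>\<in>space M. y \<omega> \<in> A} = emeasure gauss_space A"
  unfolding gauss_noise_def
  by (subst emeasure_distr[of y M gauss_space A, symmetric, unfolded vimage_def Int_def mem_Collect_eq conj_commute[of "y _ \<in> A"]])
     auto

text \<open>Switching between two noises by a coin that is unaffected by them: the coin is toggled by the
  measure-preserving map \<open>\<kappa>\<close>, which neither noise sees.\<close>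

lemma gauss_noise_toggle:
  assumes f: "gauss_noise gauss_space f" and g: "gauss_noise gauss_space g"
    and \<kappa>: "gauss_noise gauss_space \<kappa>" and P[measurable]: "Measurable.pred gauss_space P"
    and fk: "\<And>y. f (\<kappa> y) = f y" and gk: "\<And>y. g (\<kappa> y) = g y"
    and Pk: "AE y in gauss_space. P (\<kappa> y) = (\<not> P y)"
  shows "gauss_noise gauss_space (\<lambda>y. if P y then f y else g y)"
proof -
  have m: "f \<in> gauss_space \<rightarrow>\<^sub>M gauss_space" "g \<in> gauss_space \<rightarrow>\<^sub>M gauss_space" 
    and mk: "\<kappa> \<in> gauss_space \<rightarrow>\<^sub>M gauss_space"
    using f g \<kappa> by (auto simp: gauss_noise_def)
  note [measurable] = m mk
  \<comment> \<open>The map \<open>\<kappa>\<close> exchanges \<open>P\<close> and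
    \<open>\<not> P\<close> almost surely and leaves \<open>h\<close> alone, so both halves of the
    event that \<open>h\<close> lies in \<open>A\<close> have the same mass. With \<open>f\<close>
    on one half and \<open>g\<close> on the other, the two parts add up to the mass of
    \<open>A\<close>.\<close>
  have half: "emeasure gauss_space {y. P y \<and> h y \<in> A} = emeasure gauss_space {y. \<not> P y \<and> h y \<in> A}"
    if [measurable]: "h \<in> gauss_space \<rightarrow>\<^sub>M gauss_space" "A \<in> sets gauss_space" and hk: "\<And>y. h (\<kappa> y) = h y" for h :: "('a \<Rightarrow> real) \<Rightarrow> ('b \<Rightarrow> real)" and A
  proof -
    have [measurable]: "{y. P y \<and> h y \<in> A} \<in> sets gauss_space"
    proof -
      have "{y\<in>space gauss_space. P y \<and> h y \<in> A} \<in> sets gauss_space" by measurable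
      then show ?thesis by simp
    qed
    have "emeasure gauss_space {y. P y \<and> h y \<in> A} = emeasure gauss_space {y\<in>space gauss_space. \<kappa> y \<in> {y. P y \<and> h y \<in> A}}"
      by (rule gauss_noise_emeasure[OF \<kappa>, symmetric]) measurable
    also have "\<dots> = emeasure gauss_space {y\<in>space gauss_space. \<not> P y \<and> h y \<in> A}"
    proof (rule emeasure_eq_AE)
      have "{y\<in>space gauss_space. P (\<kappa> y) \<and> h y \<in> A} \<in> sets gauss_space" by measurable
      then show "{y\<in>space gauss_space. \<kappa> y \<in> {y. P y \<and> h y \<in> A}} \<in> sets gauss_space" by (simp add: hk)
    next
      show "{y\<in>space gauss_space. \<not> P y \<and> h y \<in> A} \<in> sets gauss_space" by measurable
    qed (use Pk in \<open>auto simp: hk\<close>)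
    finally show ?thesis by simp
  qed
  have "distr gauss_space gauss_space (\<lambda>y. if P y then f y else g y) = gauss_space"
  proof (rule measure_eqI)
    fix A assume "A \<in> sets (distr gauss_space gauss_space (\<lambda>y. if P y then f y else g y))"
    then have A[measurable]: "A \<in> sets gauss_space" by simp
    have "emeasure (distr gauss_space gauss_space (\<lambda>y. if P y then f y else g y)) A
      = emeasure gauss_space ({y\<in>space gauss_space. P y \<and> f y \<in> A} \<union> {y\<in>space gauss_space. \<not> P y \<and> g y \<in> A})"
      by (subst emeasure_distr) (auto intro!: arg_cong[where f="emeasure _"] split: if_splits)
    also have "\<dots> = emeasure gauss_space {y\<in>space gauss_space. P y \<and> f y \<in> A} + emeasure gauss_space {y\<in>space gauss_space. \<not> P y \<and> g y \<in> A}"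
      by (rule plus_emeasure[symmetric]) (measurable, auto)
    also have "\<dots> = emeasure gauss_space {y\<in>space gauss_space. P y \<and> f y \<in> A} + emeasure gauss_space {y\<in>space gauss_space. P y \<and> g y \<in> A}"
      using half[of g A] m gk A by simp
    finally have 1: "emeasure (distr gauss_space gauss_space (\<lambda>y. if P y then f y else g y)) A
      = emeasure gauss_space {y. P y \<and> f y \<in> A} + emeasure gauss_space {y. P y \<and> g y \<in> A}" by simp
    have 2: "emeasure gauss_space A = 2 * emeasure gauss_space {y. P y \<and> h y \<in> A}"
      if h: "gauss_noise gauss_space h" and hk: "\<And>y. h (\<kappa> y) = h y" for h :: "('a \<Rightarrow> real) \<Rightarrow> ('b \<Rightarrow> real)"
    proof -
      have [measurable]: "h \<in> gauss_space \<rightarrow>\<^sub>M gauss_space" using h by (simp add: gauss_noise_def)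
      have "emeasure gauss_space A = emeasure gauss_space {y\<in>space gauss_space. h y \<in> A}"
        using gauss_noise_emeasure[OF h A] by simp
      also have "\<dots> = emeasure gauss_space ({y\<in>space gauss_space. P y \<and> h y \<in> A} \<union> {y\<in>space gauss_space. \<not> P y \<and> h y \<in> A})"
        by (intro arg_cong[where f="emeasure _"]) auto
      also have "\<dots> = emeasure gauss_space {y\<in>space gauss_space. P y \<and> h y \<in> A} + emeasure gauss_space {y\<in>space gauss_space. \<not> P y \<and> h y \<in> A}"
        by (rule plus_emeasure[symmetric]) (measurable, auto)
      finally show ?thesis using half[of h A] hk by (simp add: mult_2)
    qed
    have "2 * emeasure gauss_space {y. P y \<and> f y \<in> A} = 2 * emeasure gauss_space {y. P y \<and> g y \<in> A}"
      using 2[OF f fk] 2[OF g gk] by simp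
    then have "emeasure gauss_space {y. P y \<and> f y \<in> A} = emeasure gauss_space {y. P y \<and> g y \<in> A}"
      by (subst (asm) ennreal_mult_cancel_left) auto
    then show "emeasure (distr gauss_space gauss_space (\<lambda>y. if P y then f y else g y)) A = emeasure gauss_space A"
      using 1 2[OF f fk] by (simp add: mult_2)
  qed simp
  then show ?thesis using m by (auto simp: gauss_noise_def)
qed

text \<open>Here the coin is a function of either noise.\<close>

lemma gauss_noise_select:
  assumes f: "gauss_noise gauss_space f" and g: "gauss_noise gauss_space g"
    and P[measurable]: "Measurable.pred gauss_space P"
    and fP: "\<And>y. P' (f y) = P y" and gP: "\<And>y. P' (g y) = P y"
    and P'[measurable]: "Measurable.pred gauss_space P'"
  shows "gauss_noise gauss_space (\<lambda>y. if P y then f y else g y)"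
proof -
  have m: "f \<in> gauss_space \<rightarrow>\<^sub>M gauss_space" "g \<in> gauss_space \<rightarrow>\<^sub>M gauss_space" 
    using f g by (auto simp: gauss_noise_def)
  note [measurable] = m
  have "distr gauss_space gauss_space (\<lambda>y. if P y then f y else g y) = gauss_space"
  proof (rule measure_eqI)
    fix A assume "A \<in> sets (distr gauss_space gauss_space (\<lambda>y. if P y then f y else g y))"
    then have A[measurable]: "A \<in> sets gauss_space" by simp
    have [measurable]: "{y\<in>space gauss_space. P' y \<and> y \<in> A} \<in> sets gauss_space"
      "{y\<in>space gauss_space. \<not> P' y \<and> y \<in> A} \<in> sets gauss_space" by measurable
    have "emeasure (distr gauss_space gauss_space (\<lambda>y. if P y then f y else g y)) A
      = emeasure gauss_space ({y\<in>space gauss_space. P y \<and> f y \<in> A} \<union> {y\<in>space gauss_space. \<not> P y \<and> g y \<in> A})"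
      by (subst emeasure_distr) (auto intro!: arg_cong[where f="emeasure _"] split: if_splits)
    also have "\<dots> = emeasure gauss_space {y\<in>space gauss_space. P y \<and> f y \<in> A} + emeasure gauss_space {y\<in>space gauss_space. \<not> P y \<and> g y \<in> A}"
      by (rule plus_emeasure[symmetric]) (measurable, auto)
    also have "{y\<in>space gauss_space. P y \<and> f y \<in> A} = {y\<in>space gauss_space. f y \<in> {y\<in>space gauss_space. P' y \<and> y \<in> A}}"
      by (simp add: fP)
    also have "emeasure gauss_space \<dots> = emeasure gauss_space {y\<in>space gauss_space. P' y \<and> y \<in> A}"
      by (rule gauss_noise_emeasure[OF f]) measurable
    also have "{y\<in>space gauss_space. \<not> P y \<and> g y \<in> A} = {y\<in>space gauss_space. g y \<in> {y\<in>space gauss_space. \<not> P' y \<and> y \<in> A}}"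
      by (simp add: gP)
    also have "emeasure gauss_space \<dots> = emeasure gauss_space {y\<in>space gauss_space. \<not> P' y \<and> y \<in> A}"
      by (rule gauss_noise_emeasure[OF g]) measurable
    also have "emeasure gauss_space {y\<in>space gauss_space. P' y \<and> y \<in> A} + emeasure gauss_space {y\<in>space gauss_space. \<not> P' y \<and> y \<in> A}
      = emeasure gauss_space ({y\<in>space gauss_space. P' y \<and> y \<in> A} \<union> {y\<in>space gauss_space. \<not> P' y \<and> y \<in> A})"
      by (rule plus_emeasure) (measurable, auto)
    also have "\<dots> = emeasure gauss_space A" by (intro arg_cong[where f="emeasure _"]) auto
    finally show "emeasure (distr gauss_space gauss_space (\<lambda>y. if P y then f y else g y)) A = emeasure gauss_space A" .
  qed simp
  then show ?thesis using m by (auto simp: gauss_noise_def)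
qed

section \<open>Standard Brownian motion from its dyadic increments\<close>

lemma sets_borel_eq_closed: "sets (borel :: real measure) = sigma_sets UNIV (Collect closed)"
proof (rule antisym)
  have "S \<in> sigma_sets UNIV (Collect closed)" if "open S" for S :: "real set"
    using sigma_sets.Compl[OF sigma_sets.Basic[of "- S" "Collect closed" UNIV]] that
    by (simp add: closed_def Compl_eq_Diff_UNIV double_diff)
  then show "sets (borel :: real measure) \<subseteq> sigma_sets UNIV (Collect closed)"
    unfolding borel_def by (auto intro!: sigma_sets_mono)
  show "sigma_sets UNIV (Collect closed) \<subseteq> sets (borel :: real measure)"
    using sets.sigma_sets_subset[of "Collect closed" "borel :: real measure"]
    by (simp add: subset_iff borel_closed)
qed

lemma closed_indicator_approx:
  assumes "closed (C :: real set)"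
  obtains h :: "nat \<Rightarrow> real \<Rightarrow> real" where
    "\<And>m. continuous_on UNIV (h m)" "\<And>m x. 0 \<le> h m x" "\<And>m x. h m x \<le> 1"
    "\<And>x. (\<lambda>m. h m x) \<longlonglongrightarrow> indicator C x"
proof (cases "C = {}")
  case True
  then show ?thesis by (intro that[of "\<lambda>_ _. 0"]) auto
next
  case False
  define h where "h = (\<lambda>m x. max 0 (1 - real m * infdist x C))"
  show ?thesis
  proof (rule that[of h])
    show "continuous_on UNIV (h m)" for m
      unfolding h_def by (intro continuous_intros)
    show "0 \<le> h m x" "h m x \<le> 1" for m x
      using infdist_nonneg[of x C] by (auto simp: h_def)
    fix x
    show "(\<lambda>m. h m x) \<longlonglongrightarrow> indicator C x"
    proof (cases "x \<in> C")
      case True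
      then show ?thesis by (simp add: h_def)
    next
      case xC: False
      then have d: "infdist x C > 0"
        using assms False by (metis in_closed_iff_infdist_zero infdist_nonneg le_less)
      have "eventually (\<lambda>m. h m x = 0) sequentially"
      proof -
        obtain n where n: "1 / infdist x C < real n" using reals_Archimedean2 by blast
        have "h m x = 0" if "m \<ge> n" for m
        proof -
          have "1 / infdist x C \<le> real m" using n that by linarith
          then have "1 \<le> real m * infdist x C" using d by (simp add: field_simps)
          then show ?thesis by (simp add: h_def)
        qed
        then show ?thesis by (auto simp: eventually_sequentially)
      qed
      then show ?thesis using xC by (simp add: tendsto_eventually)
    qed
  qed
qed

text \<open>Expectations of products of bounded continuous functions factor for each
  \<open>N\<close>, and dominated convergence keeps this in the limit. Letting the functions
  decrease to indicators of closed sets gives the product rule on closed sets, which are stable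
  under intersection and generate the Borel sets.\<close>

lemma (in prob_space) indep_vars_AE_limit:
  fixes X :: "nat \<Rightarrow> 'i \<Rightarrow> 'a \<Rightarrow> real"
  assumes I: "finite I" and ind: "\<And>N. indep_vars (\<lambda>_. borel) (X N) I"
    and Y: "\<And>i. i \<in> I \<Longrightarrow> Y i \<in> borel_measurable M"
    and lim: "\<And>i. i \<in> I \<Longrightarrow> AE \<omega> in M. (\<lambda>N. X N i \<omega>) \<longlonglongrightarrow> Y i \<omega>"
  shows "indep_vars (\<lambda>_. borel) Y I"
proof (cases "I = {}")
  case True
  then show ?thesis by (simp add: indep_vars_def indep_sets_def)
next
  case False
  have X: "X N i \<in> borel_measurable M" if "i \<in> I" for N i
    using ind[of N] that by (auto simp: indep_vars_def)
  have "prob (\<Inter>j\<in>I. Y j -` A j \<inter> space M) = (\<Prod>j\<in>I. prob (Y j -` A j \<inter> space M))"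
    if A: "A \<in> (\<Pi> i\<in>I. Collect closed)" for A
  proof -
    have "\<exists>h::nat \<Rightarrow> real \<Rightarrow> real. (\<forall>m. continuous_on UNIV (h m)) \<and> (\<forall>m x. 0 \<le> h m x) \<and> (\<forall>m x. h m x \<le> 1) \<and>
      (\<forall>x. (\<lambda>m. h m x) \<longlonglongrightarrow> indicator (A i) x)" if "i \<in> I" for i
    proof -
      have "closed (A i)" using A that by auto
      then show ?thesis by (rule closed_indicator_approx) blast
    qed
    then obtain h :: "'i \<Rightarrow> nat \<Rightarrow> real \<Rightarrow> real" where
      hc: "\<And>i m. i \<in> I \<Longrightarrow> continuous_on UNIV (h i m)" and h0: "\<And>i m x. i \<in> I \<Longrightarrow> 0 \<le> h i m x"
      and h1: "\<And>i m x. i \<in> I \<Longrightarrow> h i m x \<le> 1"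
      and hl: "\<And>i x. i \<in> I \<Longrightarrow> (\<lambda>m. h i m x) \<longlonglongrightarrow> indicator (A i) x"
      by metis
    have hm: "h i m \<in> borel_measurable borel" if "i \<in> I" for i m
      using hc[OF that] by (rule borel_measurable_continuous_onI)
    have bnd: "\<bar>\<Prod>i\<in>I. g i\<bar> \<le> 1" if "\<And>i. i \<in> I \<Longrightarrow> 0 \<le> g i \<and> g i \<le> 1" for g :: "'i \<Rightarrow> real"
      using that by (auto simp: abs_prod intro!: prod_le_1)
    have mY: "(\<lambda>\<omega>. \<Prod>i\<in>I. h i m (Y i \<omega>)) \<in> borel_measurable M" for m
      by (intro borel_measurable_prod measurable_compose[OF Y hm])
    have mX: "(\<lambda>\<omega>. \<Prod>i\<in>I. h i m (X N i \<omega>)) \<in> borel_measurable M" for m N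
      by (intro borel_measurable_prod measurable_compose[OF X hm])
    have sY: "Y i -` A i \<inter> space M \<in> sets M" if "i \<in> I" for i
      using A that by (intro measurable_sets[OF Y] borel_closed) auto
    have eq: "(\<integral>\<omega>. (\<Prod>i\<in>I. h i m (Y i \<omega>)) \<partial>M) = (\<Prod>i\<in>I. \<integral>\<omega>. h i m (Y i \<omega>) \<partial>M)" for m
    proof -
      have 1: "(\<integral>\<omega>. (\<Prod>i\<in>I. h i m (X N i \<omega>)) \<partial>M) = (\<Prod>i\<in>I. \<integral>\<omega>. h i m (X N i \<omega>) \<partial>M)" for N
      proof (rule indep_vars_lebesgue_integral[OF I])
        show "indep_vars (\<lambda>_. borel) (\<lambda>i \<omega>. h i m (X N i \<omega>)) I"
          by (rule indep_vars_compose2[OF ind]) (rule hm)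
        show "integrable M (\<lambda>\<omega>. h i m (X N i \<omega>))" if "i \<in> I" for i
          using that h0 h1 measurable_compose[OF X hm] by (intro integrable_const_bound[where B=1]) auto
      qed
      have aeX: "AE \<omega> in M. (\<lambda>N. h i m (X N i \<omega>)) \<longlonglongrightarrow> h i m (Y i \<omega>)" if "i \<in> I" for i
        using lim[OF that]
      proof eventually_elim
        case (elim \<omega>)
        then show ?case
          using hc[OF that, of m] by (intro continuous_on_tendsto_compose[of UNIV "h i m"]) auto
      qed
      have 2: "(\<lambda>N. \<integral>\<omega>. h i m (X N i \<omega>) \<partial>M) \<longlonglongrightarrow> (\<integral>\<omega>. h i m (Y i \<omega>) \<partial>M)" if "i \<in> I" for i
        using that h0 h1 aeX[OF that] measurable_compose[OF X hm] measurable_compose[OF Y hm]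
        by (intro integral_dominated_convergence[where w="\<lambda>_. 1"]) auto
      have "AE \<omega> in M. \<forall>i\<in>I. (\<lambda>N. h i m (X N i \<omega>)) \<longlonglongrightarrow> h i m (Y i \<omega>)"
        using aeX I by (intro AE_finite_allI) auto
      then have "AE \<omega> in M. (\<lambda>N. \<Prod>i\<in>I. h i m (X N i \<omega>)) \<longlonglongrightarrow> (\<Prod>i\<in>I. h i m (Y i \<omega>))"
        by eventually_elim (auto intro: tendsto_prod)
      then have "(\<lambda>N. \<integral>\<omega>. (\<Prod>i\<in>I. h i m (X N i \<omega>)) \<partial>M) \<longlonglongrightarrow> (\<integral>\<omega>. (\<Prod>i\<in>I. h i m (Y i \<omega>)) \<partial>M)"
        using mX mY bnd h0 h1 by (intro integral_dominated_convergence[where w="\<lambda>_. 1"]) auto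
      moreover have "(\<lambda>N. \<Prod>i\<in>I. \<integral>\<omega>. h i m (X N i \<omega>) \<partial>M) \<longlonglongrightarrow> (\<Prod>i\<in>I. \<integral>\<omega>. h i m (Y i \<omega>) \<partial>M)"
        using 2 by (rule tendsto_prod)
      ultimately show ?thesis unfolding 1 by (rule LIMSEQ_unique)
    qed
    have "(\<lambda>m. \<integral>\<omega>. (\<Prod>i\<in>I. h i m (Y i \<omega>)) \<partial>M) \<longlonglongrightarrow> (\<integral>\<omega>. indicat_real (\<Inter>j\<in>I. Y j -` A j \<inter> space M) \<omega> \<partial>M)"
    proof (rule integral_dominated_convergence[where w="\<lambda>_. 1"])
      show "(indicator (\<Inter>j\<in>I. Y j -` A j \<inter> space M) :: 'a \<Rightarrow> real) \<in> borel_measurable M"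
        using sY I False by (intro borel_measurable_indicator sets.finite_INT) auto
      show "AE \<omega> in M. (\<lambda>m. \<Prod>i\<in>I. h i m (Y i \<omega>)) \<longlonglongrightarrow> indicator (\<Inter>j\<in>I. Y j -` A j \<inter> space M) \<omega>"
      proof (rule AE_I2)
        fix \<omega> assume w: "\<omega> \<in> space M"
        have "(\<lambda>m. \<Prod>i\<in>I. h i m (Y i \<omega>)) \<longlonglongrightarrow> (\<Prod>i\<in>I. indicator (A i) (Y i \<omega>))"
          by (intro tendsto_prod hl)
        also have "(\<Prod>i\<in>I. indicator (A i) (Y i \<omega>)) = (indicator (\<Inter>j\<in>I. Y j -` A j \<inter> space M) \<omega> :: real)"
          using w I False by (auto simp: indicator_def prod_zero_iff)
        finally show "(\<lambda>m. \<Prod>i\<in>I. h i m (Y i \<omega>)) \<longlonglongrightarrow> indicator (\<Inter>j\<in>I. Y j -` A j \<inter> space M) \<omega>" .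
      qed
    qed (use mY bnd h0 h1 in auto)
    moreover have "(\<lambda>m. \<Prod>i\<in>I. \<integral>\<omega>. h i m (Y i \<omega>) \<partial>M) \<longlonglongrightarrow> (\<Prod>i\<in>I. \<integral>\<omega>. indicator (Y i -` A i \<inter> space M) \<omega> \<partial>M)"
    proof (intro tendsto_prod integral_dominated_convergence[where w="\<lambda>_. 1"])
      fix i assume i: "i \<in> I"
      show "AE \<omega> in M. (\<lambda>m. h i m (Y i \<omega>)) \<longlonglongrightarrow> indicator (Y i -` A i \<inter> space M) \<omega>"
      proof (rule AE_I2)
        fix \<omega> assume "\<omega> \<in> space M"
        then show "(\<lambda>m. h i m (Y i \<omega>)) \<longlonglongrightarrow> indicator (Y i -` A i \<inter> space M) \<omega>"
          using hl[OF i, of "Y i \<omega>"] by (simp add: indicator_def)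
      qed
    qed (use sY measurable_compose[OF Y hm] h0 h1 in auto)
    ultimately have "(\<integral>\<omega>. indicat_real (\<Inter>j\<in>I. Y j -` A j \<inter> space M) \<omega> \<partial>M) = (\<Prod>i\<in>I. \<integral>\<omega>. indicat_real (Y i -` A i \<inter> space M) \<omega> \<partial>M)"
      unfolding eq by (rule LIMSEQ_unique)
    moreover have "(\<Inter>j\<in>I. Y j -` A j \<inter> space M) \<inter> space M = (\<Inter>j\<in>I. Y j -` A j \<inter> space M)"
      using False by auto
    ultimately show ?thesis by simp
  qed
  then show ?thesis
    using I False Y by (subst indep_vars_finite[where E="\<lambda>_. Collect closed"])
      (auto simp: sets_borel_eq_closed Int_stable_def)
qed

text \<open>Characteristic functions pass to the limit by dominated convergence and determine the
  law.\<close>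

lemma (in prob_space) std_normal_AE_limit:
  assumes X: "\<And>N. distributed M lborel (X N) std_normal_density"
    and Y: "Y \<in> borel_measurable M" and lim: "AE \<omega> in M. (\<lambda>N. X N \<omega>) \<longlonglongrightarrow> (Y \<omega> :: real)"
  shows "distributed M lborel Y std_normal_density"
proof -
  have mX: "X N \<in> borel_measurable M" for N using distributed_measurable[OF X] by simp
  have dX: "distr M borel (X N) = std_normal_distribution" for N
  proof -
    have "distr M borel (X N) = distr M lborel (X N)" by (rule distr_cong) auto
    then show ?thesis using distributed_distr_eq_density[OF X] by simp
  qed
  have "char (distr M borel Y) = char std_normal_distribution"
  proof
    fix u
    have "(\<lambda>N. \<integral>\<omega>. iexp (u * X N \<omega>) \<partial>M) \<longlonglongrightarrow> (\<integral>\<omega>. iexp (u * Y \<omega>) \<partial>M)"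
    proof (rule integral_dominated_convergence[where w="\<lambda>_. 1"])
      show "AE \<omega> in M. (\<lambda>N. iexp (u * X N \<omega>)) \<longlonglongrightarrow> iexp (u * Y \<omega>)"
        using lim by eventually_elim (intro tendsto_intros)
    qed (use mX Y in auto)
    moreover have "(\<integral>\<omega>. iexp (u * X N \<omega>) \<partial>M) = char std_normal_distribution u" for N
      using mX[of N] by (simp add: char_def dX[of N, symmetric] integral_distr)
    moreover have "(\<integral>\<omega>. iexp (u * Y \<omega>) \<partial>M) = char (distr M borel Y) u"
      using Y by (simp add: char_def integral_distr)
    ultimately show "char (distr M borel Y) u = char std_normal_distribution u"
      by (simp add: LIMSEQ_const_iff)
  qed
  then have "distr M borel Y = std_normal_distribution"
    using Y real_dist_normal_dist by (intro Levy_uniqueness real_distribution_distr) auto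
  moreover have "distr M borel Y = distr M lborel Y" by (rule distr_cong) auto
  ultimately show ?thesis using Y by (simp add: distributed_def)
qed


lemma dyadic_floor_tendsto: "(\<lambda>N. real (nat \<lfloor>t * 2 ^ N\<rfloor>) / 2 ^ N) \<longlonglongrightarrow> t" if "0 \<le> t"
proof (rule tendsto_sandwich)
  have "real (nat \<lfloor>t * 2 ^ N\<rfloor>) = of_int \<lfloor>t * 2 ^ N\<rfloor>" for N using that by simp
  then have *: "t * 2 ^ N - 1 \<le> real (nat \<lfloor>t * 2 ^ N\<rfloor>)" "real (nat \<lfloor>t * 2 ^ N\<rfloor>) \<le> t * 2 ^ N" for N
    using floor_correct[of "t * 2 ^ N"] by (simp_all only:) linarith+
  have "t - (1/2) ^ N = (t * 2 ^ N - 1) / 2 ^ N" for N by (simp add: field_simps power_divide)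
  then show "\<forall>\<^sub>F N in sequentially. t - (1/2) ^ N \<le> real (nat \<lfloor>t * 2 ^ N\<rfloor>) / 2 ^ N"
    using divide_right_mono[OF *(1)] by (simp del: of_nat_nat)
  have "t = (t * 2 ^ N) / 2 ^ N" for N by simp
  then show "\<forall>\<^sub>F N in sequentially. real (nat \<lfloor>t * 2 ^ N\<rfloor>) / 2 ^ N \<le> t"
    using *(2) by (auto intro!: always_eventually simp: field_simps)
  have "(\<lambda>N. t - (1/2) ^ N) \<longlonglongrightarrow> t - 0"
    by (intro tendsto_intros LIMSEQ_power_zero) auto
  then show "(\<lambda>N. t - (1/2) ^ N) \<longlonglongrightarrow> t" by simp
qed simp

text \<open>Arbitrary times are rounded down to the grid of mesh \<open>1 / 2 ^ N\<close>. There the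
  increments are sums of noise over disjoint ranges of indices, hence independent and normal.
  Continuity makes them converge to the true increments, and the two limit lemmas apply.\<close>

lemma (in prob_space) standard_BM_dyadicI:
  fixes B :: "real \<Rightarrow> 'a \<Rightarrow> real" and Y :: "nat \<Rightarrow> 'a \<Rightarrow> nat \<Rightarrow> real"
  assumes meas: "\<And>t. 0 \<le> t \<Longrightarrow> B t \<in> borel_measurable M"
    and zero: "\<And>\<omega>. B 0 \<omega> = 0"
    and cont: "AE \<omega> in M. continuous_on {0..} (\<lambda>t. B t \<omega>)"
    and noise: "\<And>N. gauss_noise M (Y N)"
    and incr: "\<And>N k \<omega>. B (real (Suc k) / 2 ^ N) \<omega> - B (real k / 2 ^ N) \<omega> = Y N \<omega> k / sqrt (2 ^ N)"
  shows "standard_BM B"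
proof -
  define j where "j N t = nat \<lfloor>t * 2 ^ N\<rfloor>" for N and t :: real
  have jmono: "j N s \<le> j N t" if "s \<le> t" for N s t
    unfolding j_def using that by (intro nat_mono floor_mono) auto
  have jlim: "(\<lambda>N. real (j N t) / 2 ^ N) \<longlonglongrightarrow> t" if "0 \<le> t" for t
    unfolding j_def by (rule dyadic_floor_tendsto[OF that])
  define Z where "Z N s t \<omega> = (\<Sum>k\<in>{j N s..<j N t}. Y N \<omega> k / sqrt (2 ^ N))" for N s t \<omega>
  have Zeq: "Z N s t \<omega> = B (real (j N t) / 2 ^ N) \<omega> - B (real (j N s) / 2 ^ N) \<omega>" if "s \<le> t" for N s t \<omega>
    unfolding Z_def incr[symmetric] by (rule sum_Suc_diff'[OF jmono[OF that]])
  have Zlim: "AE \<omega> in M. (\<lambda>N. Z N s t \<omega>) \<longlonglongrightarrow> B t \<omega> - B s \<omega>" if "0 \<le> s" "s \<le> t" for s t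
    using cont
  proof eventually_elim
    case (elim \<omega>)
    have "(\<lambda>N. B (real (j N u) / 2 ^ N) \<omega>) \<longlonglongrightarrow> B u \<omega>" if "0 \<le> u" for u
      using jlim[OF that] that by (intro continuous_on_tendsto_compose[OF elim]) auto
    then show ?case using that unfolding Zeq[OF that(2)] by (intro tendsto_diff) auto
  qed
  have iY: "indep_vars (\<lambda>_. borel) (\<lambda>k \<omega>. Y N \<omega> k) UNIV" for N
    by (rule gauss_noise_indep[OF _ noise]) unfold_locales
  have nY: "distributed M lborel (\<lambda>\<omega>. Y N \<omega> k) std_normal_density" for N k
    by (rule gauss_noise_indep[OF _ noise]) unfold_locales
  have Zdist: "distributed M lborel (Z N s t) (normal_density 0 (sqrt ((real (j N t) - real (j N s)) / 2 ^ N)))"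
    if "j N s < j N t" for N s t
  proof -
    let ?X = "\<lambda>k \<omega>. Y N \<omega> k / sqrt (2 ^ N)"
    have "distributed M lborel (\<lambda>\<omega>. 0 + (1 / sqrt (2 ^ N)) * Y N \<omega> k)
      (normal_density (0 + (1 / sqrt (2 ^ N)) * 0) (\<bar>1 / sqrt (2 ^ N)\<bar> * 1))" for k
      by (rule normal_density_affine[OF nY]) auto
    then have "distributed M lborel (\<lambda>\<omega>. \<Sum>k\<in>{j N s..<j N t}. ?X k \<omega>) (normal_density (\<Sum>k\<in>{j N s..<j N t}. 0) (sqrt (\<Sum>k\<in>{j N s..<j N t}. (1 / sqrt (2 ^ N))\<^sup>2)))"
      using that
      by (intro sum_indep_normal indep_vars_compose2[OF indep_vars_subset[OF iY], where Y="\<lambda>_ x. x / sqrt (2 ^ N)"]) auto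
    then show ?thesis
      unfolding Z_def[abs_def] using that by (simp add: power_divide of_nat_diff)
  qed
  have dist: "distributed M lborel (\<lambda>\<omega>. B t \<omega> - B s \<omega>) (normal_density 0 (sqrt (t - s)))" if st: "0 \<le> s" "s < t" for s t
  proof -
    define v where "v N = (real (j N t) - real (j N s)) / 2 ^ N" for N
    have v: "v \<longlonglongrightarrow> t - s"
      unfolding v_def[abs_def] diff_divide_distrib using st by (intro tendsto_diff jlim) auto
    then have "eventually (\<lambda>N. v N > 0) sequentially"
      using st by (intro order_tendstoD) auto
    \<comment> \<open>At coarse levels \<open>s\<close> and \<open>t\<close> may round to the same
      grid point, where the increment is 0 and cannot be normalised. The sequence is therefore
      started at \<open>N0\<close>.\<close>
    then obtain N0 where N0: "\<And>N. N \<ge> N0 \<Longrightarrow> v N > 0" by (auto simp: eventually_sequentially)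
    have v0: "v (N + N0) > 0" for N by (rule N0) simp
    then have lt: "j (N + N0) s < j (N + N0) t" for N
      by (metis v_def diff_gt_0_iff_gt of_nat_less_iff zero_less_divide_iff zero_less_numeral zero_less_power order_less_asym)
    have "distributed M lborel (\<lambda>\<omega>. (Z (N + N0) s t \<omega> - 0) / sqrt (v (N + N0))) std_normal_density" for N
      using Zdist[OF lt, of N] v0[of N] by (subst normal_standard_normal_convert[symmetric]) (auto simp: v_def)
    then have 1: "distributed M lborel (\<lambda>\<omega>. Z (N + N0) s t \<omega> / sqrt (v (N + N0))) std_normal_density" for N
      by simp
    have "distributed M lborel (\<lambda>\<omega>. (B t \<omega> - B s \<omega>) / sqrt (t - s)) std_normal_density"
    proof (rule std_normal_AE_limit[OF 1])
      show "(\<lambda>\<omega>. (B t \<omega> - B s \<omega>) / sqrt (t - s)) \<in> borel_measurable M"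
        using meas[of s] meas[of t] st by simp
      have "AE \<omega> in M. (\<lambda>N. Z N s t \<omega>) \<longlonglongrightarrow> B t \<omega> - B s \<omega>" using st by (intro Zlim) auto
      then show "AE \<omega> in M. (\<lambda>N. Z (N + N0) s t \<omega> / sqrt (v (N + N0))) \<longlonglongrightarrow> (B t \<omega> - B s \<omega>) / sqrt (t - s)"
      proof eventually_elim
        case (elim \<omega>)
        have "(\<lambda>N. Z N s t \<omega> / sqrt (v N)) \<longlonglongrightarrow> (B t \<omega> - B s \<omega>) / sqrt (t - s)"
          using st by (intro tendsto_divide elim tendsto_real_sqrt v) auto
        then show ?case by (rule LIMSEQ_ignore_initial_segment)
      qed
    qed
    then have "distributed M lborel (\<lambda>\<omega>. ((B t \<omega> - B s \<omega>) - 0) / sqrt (t - s)) std_normal_density" by simp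
    then show ?thesis using st by (subst normal_standard_normal_convert) auto
  qed
  have ind: "indep_vars (\<lambda>_. borel) (\<lambda>i \<omega>. B (t (Suc i)) \<omega> - B (t i) \<omega>) {..<n}"
    if t: "0 \<le> t 0" "mono_on {..n} t" for n and t :: "nat \<Rightarrow> real"
  proof (rule indep_vars_AE_limit[where X="\<lambda>N i. Z N (t i) (t (Suc i))"])
    have tm: "t i \<le> t k" if "i \<le> k" "k \<le> n" for i k
      using t(2) that by (auto simp: mono_on_def)
    have t0: "0 \<le> t i" if "i \<le> n" for i using tm[of 0 i] t that by auto
    fix N
    have "indep_vars (\<lambda>i. PiM {j N (t i)..<j N (t (Suc i))} (\<lambda>_. borel))
       (\<lambda>i \<omega>. restrict (\<lambda>k. Y N \<omega> k) {j N (t i)..<j N (t (Suc i))}) {..<n}"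
    proof (rule indep_vars_restrict[OF iY])
      show "disjoint_family_on (\<lambda>i. {j N (t i)..<j N (t (Suc i))}) {..<n}"
      proof -
        have "{j N (t i)..<j N (t (Suc i))} \<inter> {j N (t k)..<j N (t (Suc k))} = {}" if "i < k" "k < n" for i k
          using jmono[OF tm[of "Suc i" k], of N] that by auto
        then show ?thesis unfolding disjoint_family_on_def
          by (metis Int_commute lessThan_iff nat_neq_iff)
      qed
    qed simp
    then have "indep_vars (\<lambda>_. borel) (\<lambda>i \<omega>. (\<lambda>p. \<Sum>k\<in>{j N (t i)..<j N (t (Suc i))}. p k / sqrt (2 ^ N))
        (restrict (\<lambda>k. Y N \<omega> k) {j N (t i)..<j N (t (Suc i))})) {..<n}"
      by (rule indep_vars_compose2)
         (intro borel_measurable_sum borel_measurable_divide measurable_component_singleton measurable_const; simp)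
    then show "indep_vars (\<lambda>_. borel) (\<lambda>i. Z N (t i) (t (Suc i))) {..<n}"
      by (simp add: Z_def[abs_def])
  next
    fix i assume "i \<in> {..<n}"
    then have i: "0 \<le> t i" "t i \<le> t (Suc i)" "0 \<le> t (Suc i)"
      using t mono_onD[OF t(2), of 0 i] mono_onD[OF t(2), of i "Suc i"] by auto
    show "(\<lambda>\<omega>. B (t (Suc i)) \<omega> - B (t i) \<omega>) \<in> borel_measurable M"
      using i by (intro borel_measurable_diff meas)
    show "AE \<omega> in M. (\<lambda>N. Z N (t i) (t (Suc i)) \<omega>) \<longlonglongrightarrow> B (t (Suc i)) \<omega> - B (t i) \<omega>"
      using i by (intro Zlim)
  qed simp
  show ?thesis
    unfolding standard_BM_def using meas zero cont dist ind by auto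
qed

section \<open>The rearranged sequence of letters\<close>

text \<open>Finite-dimensional laws determine the noise, so the comparison noise may change with
  \<open>J\<close>. This is what the final sequence of letters needs: any finite part of it is
  visible at some finite stage, but no stage shows all of it.\<close>

lemma gauss_noise_local:
  fixes y :: "'a \<Rightarrow> 'i \<Rightarrow> real"
  assumes "\<And>J. finite J \<Longrightarrow> \<exists>y'. gauss_noise M y' \<and> (\<forall>\<omega>\<in>space M. \<forall>i\<in>J. y \<omega> i = y' \<omega> i)"
  shows "gauss_noise M y"
proof (rule gauss_noiseI)
  fix i
  obtain y' where "gauss_noise M y'" and eq: "\<forall>\<omega>\<in>space M. y \<omega> i = y' \<omega> i"
    using assms[of "{i}"] by auto
  then show "(\<lambda>\<omega>. y \<omega> i) \<in> borel_measurable M"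
    using gauss_noise_measurable[of M y' i] eq by (subst measurable_cong[of M _ "\<lambda>\<omega>. y' \<omega> i"]) auto
next
  fix J :: "'i set" and A :: "'i \<Rightarrow> real set"
  assume J: "finite J" and A: "\<And>i. i \<in> J \<Longrightarrow> A i \<in> sets borel"
  obtain y' where y': "gauss_noise M y'" and eq: "\<forall>\<omega>\<in>space M. \<forall>i\<in>J. y \<omega> i = y' \<omega> i"
    using assms[OF J] by auto
  have "{\<omega>\<in>space M. \<forall>i\<in>J. y \<omega> i \<in> A i} = {\<omega>\<in>space M. \<forall>i\<in>J. y' \<omega> i \<in> A i}"
    using eq by auto
  then show "emeasure M {\<omega>\<in>space M. \<forall>i\<in>J. y \<omega> i \<in> A i} = (\<Prod>i\<in>J. emeasure std_normal_distribution (A i))"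
    using gauss_noise_box[OF y' J A] by simp
qed

text \<open>The root of the block length is the standard deviation of an increment over a block; it dominates the
  length \<open>m\<close> of the current word and the bound \<open>n\<close> on the displacement of the origin.\<close>

definition block :: "nat \<Rightarrow> nat \<Rightarrow> nat" where
  "block n m = (16 * (n + m + 1))\<^sup>2"

primrec len :: "nat \<Rightarrow> nat" where
  "len 0 = 0"
| "len (Suc n) = len n + 3 * block n (len n)"

definition blk :: "nat \<Rightarrow> nat" where
  "blk n = block n (len n)"

lemma len_Suc: "len (Suc n) = len n + 3 * blk n"
  by (simp add: blk_def)

declare len.simps(2)[simp del]

lemma blk_pos: "blk n \<ge> 1"
  by (simp add: blk_def block_def)

text \<open>A row is a letter and its columns are the entries of that letter, so only whole letters
  are moved.\<close>

definition select_rows :: "(nat \<Rightarrow> nat) \<Rightarrow> (nat \<times> nat \<Rightarrow> real) \<Rightarrow> nat \<times> nat \<Rightarrow> real" where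
  "select_rows \<sigma> y = (\<lambda>(i, m). y (\<sigma> i, m))"

lemma select_rows_apply[simp]: "select_rows \<sigma> y (i, m) = y (\<sigma> i, m)"
  by (simp add: select_rows_def)

lemma gauss_noise_select_rows: "inj \<sigma> \<Longrightarrow> gauss_noise gauss_space (select_rows \<sigma>)"
  using gauss_noise_reindex[of "\<lambda>(i, m). (\<sigma> i, m)"]
  by (simp add: select_rows_def[abs_def] inj_def case_prod_unfold)

definition block_positive :: "nat \<Rightarrow> nat \<Rightarrow> (nat \<times> nat \<Rightarrow> real) \<Rightarrow> bool" where
  "block_positive i b y \<longleftrightarrow> 0 < (\<Sum>k<b. y (i + k, 0))"

lemma block_positive_measurable[measurable]: "Measurable.pred gauss_space (block_positive i b)"
  unfolding block_positive_def by measurable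

text \<open>\<open>coin\<close> reads the signs of \<open>U\<close> and \<open>U'\<close> before the rearrangement, \<open>agree\<close> after it.\<close>

definition coin :: "nat \<Rightarrow> (nat \<times> nat \<Rightarrow> real) \<Rightarrow> bool" where
  "coin n y \<longleftrightarrow> block_positive (len n) (blk n) y = block_positive (len n + 2 * blk n) (blk n) y"

definition agree :: "nat \<Rightarrow> (nat \<times> nat \<Rightarrow> real) \<Rightarrow> bool" where
  "agree n y \<longleftrightarrow> block_positive 0 (blk n) y = block_positive (len n + 2 * blk n) (blk n) y"

lemma coin_measurable[measurable]: "Measurable.pred gauss_space (coin n)"
  unfolding coin_def by measurable

lemma agree_measurable[measurable]: "Measurable.pred gauss_space (agree n)"
  unfolding agree_def by measurable

text \<open>Used with \<open>select_rows\<close>, this moves the \<open>p\<close> letters that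
  follow the first \<open>l\<close> in front of them. With \<open>l = len n\<close>, the choice
  \<open>p = 2 * blk n\<close> gives \<open>U D (V n) U'\<close> and \<open>p = blk n\<close> gives
  \<open>U (V n) D U'\<close>.\<close>

definition place :: "nat \<Rightarrow> nat \<Rightarrow> nat \<Rightarrow> nat" where
  "place p l i = (if i < p then l + i else if i < p + l then i - p else i)"

lemma inj_place: "inj (place p l)"
  by (auto simp: inj_def place_def split: if_splits)

definition offset :: "nat \<Rightarrow> (nat \<times> nat \<Rightarrow> real) \<Rightarrow> nat" where
  "offset n y = (if coin n y then 2 * blk n else blk n)"

text \<open>The first \<open>len n\<close> letters of \<open>word n z\<close> form \<open>V n\<close>; the remaining ones are still those of \<open>z\<close>, the
  next \<open>3 * blk n\<close> of them being \<open>U\<close>, \<open>D\<close>, \<open>U'\<close> in this order.\<close>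

primrec word :: "nat \<Rightarrow> (nat \<times> nat \<Rightarrow> real) \<Rightarrow> nat \<times> nat \<Rightarrow> real" where
  "word 0 z = z"
| "word (Suc n) z = select_rows (place (offset n (word n z)) (len n)) (word n z)"

definition left :: "nat \<Rightarrow> (nat \<times> nat \<Rightarrow> real) \<Rightarrow> nat" where
  "left n z = offset n (word n z)"

lemma left_bounds: "blk n \<le> left n z" "left n z \<le> 2 * blk n"
  by (auto simp: left_def offset_def)

text \<open>In both orders \<open>U\<close> comes first and \<open>U'\<close> stays last, so the
  coin can be read off from the new word without knowing which order was taken.\<close>

lemma agree_place:
  assumes "blk n \<le> p" "p \<le> 2 * blk n"
  shows "agree n (select_rows (place p (len n)) y) = coin n y"
  using assms by (auto simp: agree_def coin_def block_positive_def place_def intro!: arg_cong2[where f="(=)"])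

lemma agree_word: "agree n (word (Suc n) z) = coin n (word n z)"
  by (simp add: agree_place left_bounds[unfolded left_def])

lemma gauss_noise_word: "gauss_noise gauss_space (word n)"
proof (induction n)
  case 0
  show ?case using gauss_noise_select_rows[of "\<lambda>i. i"] by (simp add: select_rows_def[abs_def])
next
  case (Suc n)
  have "gauss_noise gauss_space (\<lambda>y. if coin n y then select_rows (place (2 * blk n) (len n)) y else select_rows (place (blk n) (len n)) y)"
    by (rule gauss_noise_select[where P'="agree n"])
       (auto intro: gauss_noise_select_rows inj_place simp: agree_place)
  then have "gauss_noise gauss_space (\<lambda>y. select_rows (place (offset n y) (len n)) y)"
    by (simp add: offset_def if_distrib if_distribR cong: if_cong)
  from gauss_noise_comp[OF Suc this] show ?case by (simp add: word.simps(2))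
qed

lemma word_Suc_inner: "i < len n \<Longrightarrow> word (Suc n) z (left n z + i, m) = word n z (i, m)"
  by (simp add: left_def place_def)

text \<open>\<open>V n\<close> occupies the places from \<open>start n\<close> up to, but excluding, \<open>stop n\<close>.\<close>

primrec start :: "nat \<Rightarrow> (nat \<times> nat \<Rightarrow> real) \<Rightarrow> int" where
  "start 0 z = 0"
| "start (Suc n) z = start n z - int (left n z)"

declare word.simps(2)[simp del] start.simps(2)[simp del]

definition stop :: "nat \<Rightarrow> (nat \<times> nat \<Rightarrow> real) \<Rightarrow> int" where
  "stop n z = start n z + int (len n)"

lemma stop_0[simp]: "stop 0 z = 0" by (simp add: stop_def)

lemma stop_Suc: "stop (Suc n) z = stop n z + int (3 * blk n - left n z)"
  using left_bounds[of n z] by (simp add: stop_def len_Suc of_nat_diff start.simps(2))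

lemma start_antimono: "n \<le> N \<Longrightarrow> start N z \<le> start n z"
  by (induction N rule: dec_induct) (auto simp: start.simps(2))

lemma stop_mono: "n \<le> N \<Longrightarrow> stop n z \<le> stop N z"
  by (induction N rule: dec_induct) (auto simp: stop_Suc)

lemma start_le: "start n z \<le> - int n"
proof (induction n)
  case (Suc n)
  then show ?case using left_bounds(1)[of n z] blk_pos[of n] by (simp add: start.simps(2))
qed simp

lemma stop_ge: "stop n z \<ge> int n"
proof (induction n)
  case (Suc n)
  have "3 * blk n - left n z \<ge> 1" using left_bounds(2)[of n z] blk_pos[of n] by linarith
  then show ?case using Suc by (simp add: stop_Suc)
qed simp

lemma word_inner:
  assumes "n \<le> N" "i < len n"
  shows "word N z (nat (start n z - start N z) + i, m) = word n z (i, m)"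
  using assms(1)
proof (induction N rule: dec_induct)
  case (step N)
  have "start n z + int (len n) \<le> start N z + int (len N)"
    using stop_mono[OF step(1)] by (simp add: stop_def)
  then have "nat (start n z - start N z) + i < len N"
    using assms(2) start_antimono[OF step(1), of z] by linarith
  then have "word (Suc N) z (left N z + (nat (start n z - start N z) + i), m) = word n z (i, m)"
    by (subst word_Suc_inner) (auto simp: step.IH)
  moreover have "nat (start n z - start (Suc N) z) + i = left N z + (nat (start n z - start N z) + i)"
    using start_antimono[OF step(1), of z] by (simp add: start.simps(2))
  ultimately show ?case by (simp only:)
qed simp

text \<open>The choice of \<open>N\<close> is immaterial as long as \<open>V N\<close> covers the place \<open>k\<close>.\<close>

definition eta :: "(nat \<times> nat \<Rightarrow> real) \<Rightarrow> int \<Rightarrow> nat \<Rightarrow> real" where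
  "eta z k m = (let N = nat \<bar>k\<bar> + 1 in word N z (nat (k - start N z), m))"

lemma eta_eq:
  assumes k: "start N z \<le> k" "k < stop N z"
  shows "eta z k m = word N z (nat (k - start N z), m)"
proof -
  have *: "word N' z (nat (k - start N' z), m) = word N z (nat (k - start N z), m)"
    if "N \<le> N'" "start N z \<le> k" "k < stop N z" for N N'
  proof -
    have "nat (k - start N z) < len N" using that by (simp add: stop_def)
    from word_inner[OF that(1) this, of z m]
    have "word N' z (nat (start N z - start N' z) + nat (k - start N z), m) = word N z (nat (k - start N z), m)" .
    moreover have "nat (start N z - start N' z) + nat (k - start N z) = nat (k - start N' z)"
      using that(2) start_antimono[OF that(1), of z] by simp
    ultimately show ?thesis by simp
  qed
  define K where "K = nat \<bar>k\<bar> + 1"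
  have K: "start K z \<le> k" "k < stop K z"
    using start_le[of K z] stop_ge[of K z] unfolding K_def by linarith+
  have "word K z (nat (k - start K z), m) = word N z (nat (k - start N z), m)"
    using *[of N K] *[of K N] k K by (cases "N \<le> K") auto
  then show ?thesis by (simp add: eta_def K_def Let_def)
qed

section \<open>The letters seen from either end of a word\<close>

lemma AE_block_sum_nonzero:
  assumes "b \<ge> (1::nat)"
  shows "AE y in gauss_space. (\<Sum>k<b. y (k, 0 :: nat)) \<noteq> (0::real)"
proof -
  interpret prob_space "gauss_space :: (nat \<times> nat \<Rightarrow> real) measure" by (rule prob_space_gauss)
  have id: "gauss_noise gauss_space (\<lambda>y :: nat \<times> nat \<Rightarrow> real. y)"
    using gauss_noise_reindex[of "\<lambda>i. i"] by simp
  have "indep_vars (\<lambda>_. borel) (\<lambda>k y. y (k, 0::nat)) {..<b}"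
  proof -
    have "gauss_noise gauss_space (\<lambda>y (k::nat). y (k, 0::nat) :: real)"
      by (rule gauss_noise_reindex) (simp add: inj_def)
    from gauss_noise_indep(1)[OF prob_space_gauss this] show ?thesis
      by (rule indep_vars_subset) simp
  qed
  then have D: "distributed gauss_space lborel (\<lambda>y. \<Sum>k<b. y (k, 0 :: nat)) (normal_density (\<Sum>k<b. 0) (sqrt (\<Sum>k<b. 1\<^sup>2)))"
    using assms by (intro sum_indep_normal gauss_noise_indep(2)[OF prob_space_gauss id]) (auto simp: lessThan_empty_iff)
  then have dd: "distr gauss_space lborel (\<lambda>y. \<Sum>k<b. y (k, 0 :: nat)) = density lborel (normal_density 0 (sqrt b))"
    by (simp add: distributed_distr_eq_density)
  have "AE x in density lborel (\<lambda>x. ennreal (normal_density 0 (sqrt b) x)). x \<noteq> 0"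
    by (subst AE_density) (auto intro: AE_lborel_singleton[THEN AE_mp])
  then have "AE x in distr gauss_space lborel (\<lambda>y. \<Sum>k<b. y (k, 0 :: nat)). x \<noteq> (0::real)"
    unfolding dd .
  then show ?thesis
    by (subst (asm) AE_distr_iff) auto
qed

text \<open>Negating the letters of the first block toggles \<open>agree n\<close>, provided that
  their sum is not 0. As \<open>p\<close> and \<open>q\<close> are at least \<open>blk n\<close>,
  all these letters are dropped, so what is kept does not see the toggling.\<close>

lemma gauss_noise_drop:
  assumes "blk n \<le> p" "blk n \<le> q"
  shows "gauss_noise gauss_space (\<lambda>y. select_rows (\<lambda>i. (if agree n y then p else q) + i) y)"
proof -
  define \<kappa> :: "(nat \<times> nat \<Rightarrow> real) \<Rightarrow> nat \<times> nat \<Rightarrow> real" where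
    "\<kappa> y j = (if fst j < blk n then -1 else 1) * y j" for y j
  have "gauss_noise gauss_space (\<lambda>y. if agree n y then select_rows (\<lambda>i. p + i) y else select_rows (\<lambda>i. q + i) y)"
  proof (rule gauss_noise_toggle[where \<kappa>=\<kappa>])
    show "gauss_noise gauss_space \<kappa>"
      unfolding \<kappa>_def[abs_def] by (rule gauss_noise_sign) auto
    show "select_rows (\<lambda>i. p + i) (\<kappa> y) = select_rows (\<lambda>i. p + i) y" "select_rows (\<lambda>i. q + i) (\<kappa> y) = select_rows (\<lambda>i. q + i) y" for y
      using assms by (auto simp: fun_eq_iff \<kappa>_def)
    have 1: "block_positive (len n + 2 * blk n) (blk n) (\<kappa> y) = block_positive (len n + 2 * blk n) (blk n) y" for y
      by (simp add: block_positive_def \<kappa>_def)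
    have 2: "block_positive 0 (blk n) (\<kappa> y) \<longleftrightarrow> (\<Sum>k<blk n. y (k, 0)) < 0" for y
      by (simp add: block_positive_def \<kappa>_def sum_negf)
    show "AE y in gauss_space. agree n (\<kappa> y) = (\<not> agree n y)"
      using AE_block_sum_nonzero[OF blk_pos[of n]]
    proof eventually_elim
      case (elim y)
      then show ?case by (auto simp: agree_def 1 2 block_positive_def[of 0 "blk n" y])
    qed
  qed (auto intro!: gauss_noise_select_rows simp: inj_def)
  moreover have "(\<lambda>y. if agree n y then select_rows (\<lambda>i. p + i) y else select_rows (\<lambda>i. q + i) y)
    = (\<lambda>y. select_rows (\<lambda>i. (if agree n y then p else q) + i) y)"
    by (auto simp: fun_eq_iff select_rows_def)
  ultimately show ?thesis by (simp only:)
qed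

lemma agree_cong:
  "(\<And>i. i < len (Suc n) \<Longrightarrow> y (i, 0) = y' (i, 0)) \<Longrightarrow> agree n y = agree n y'"
  unfolding agree_def block_positive_def len_Suc
  by (intro arg_cong2[where f="(=)"] arg_cong2[where f="(<)"] sum.cong refl) auto

text \<open>The letters from the left end of \<open>V n\<close> onwards as they stand at stage
  \<open>N\<close>. Beyond \<open>V N\<close> come the fresh letters not yet used, which makes the
  sequence infinite.\<close>

definition fwd :: "nat \<Rightarrow> nat \<Rightarrow> (nat \<times> nat \<Rightarrow> real) \<Rightarrow> nat \<times> nat \<Rightarrow> real" where
  "fwd N n z = select_rows (\<lambda>i. nat (start n z - start N z) + i) (word N z)"

text \<open>The induction runs downwards from \<open>N\<close>, where the sequence is the whole
  word. Passing from \<open>V (n + 1)\<close> to \<open>V n\<close> drops the \<open>left n\<close>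
  letters in front of \<open>V n\<close>, and this number is a function of the sequence already
  reached, so \<open>gauss_noise_drop\<close> applies to it.\<close>

lemma gauss_noise_fwd: "n \<le> N \<Longrightarrow> gauss_noise gauss_space (fwd N n)"
proof (induction n rule: inc_induct)
  case base
  show ?case using gauss_noise_word[of N] by (simp add: fwd_def[abs_def] select_rows_def[abs_def])
next
  case (step n)
  have eq: "fwd N n z = (\<lambda>y. select_rows (\<lambda>i. (if agree n y then 2 * blk n else blk n) + i) y) (fwd N (Suc n) z)" for z
  proof -
    have "agree n (fwd N (Suc n) z) = agree n (word (Suc n) z)"
      using step(1,2) by (intro agree_cong) (simp add: fwd_def word_inner)
    then have "left n z = (if agree n (fwd N (Suc n) z) then 2 * blk n else blk n)"
      by (simp add: left_def offset_def agree_word)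
    moreover have "nat (start n z - start N z) = left n z + nat (start (Suc n) z - start N z)"
      using start_antimono[of "Suc n" N z] step(1,2) by (simp add: start.simps(2))
    ultimately show ?thesis
      by (simp add: fwd_def fun_eq_iff select_rows_def add_ac)
  qed
  have "gauss_noise gauss_space (\<lambda>z. (\<lambda>y. select_rows (\<lambda>i. (if agree n y then 2 * blk n else blk n) + i) y) (fwd N (Suc n) z))"
    by (rule gauss_noise_comp[OF step.IH gauss_noise_drop]) simp_all
  moreover have "fwd N n = (\<lambda>z. (\<lambda>y. select_rows (\<lambda>i. (if agree n y then 2 * blk n else blk n) + i) y) (fwd N (Suc n) z))"
    by (rule ext) (rule eq)
  ultimately show ?case by (simp only:)
qed

definition reversal :: "nat \<Rightarrow> nat \<Rightarrow> nat" where
  "reversal L i = (if i < L then L - 1 - i else i)"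

definition bwd :: "nat \<Rightarrow> nat \<Rightarrow> (nat \<times> nat \<Rightarrow> real) \<Rightarrow> nat \<times> nat \<Rightarrow> real" where
  "bwd N n z = select_rows (\<lambda>i. reversal (len N) (nat (stop N z - stop n z) + i)) (word N z)"

lemma bwd_inner:
  assumes "n \<le> N" "i < len n"
  shows "bwd N n z (i, m) = word n z (len n - 1 - i, m)"
proof -
  have "start N z \<le> start n z" "stop n z \<le> stop N z"
    using assms start_antimono stop_mono by auto
  then have "reversal (len N) (nat (stop N z - stop n z) + i) = nat (start n z - start N z) + (len n - 1 - i)"
    using assms(2) by (auto simp: reversal_def stop_def)
  moreover have "word N z (nat (start n z - start N z) + (len n - 1 - i), m) = word n z (len n - 1 - i, m)"
    by (rule word_inner) (use assms in auto)
  ultimately show ?thesis by (simp add: bwd_def)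
qed

text \<open>Agreement of two signs is symmetric, so reversing the word exchanges \<open>U\<close>
  and \<open>U'\<close> without changing the coin. Hence \<open>gauss_noise_drop\<close> also serves
  for the right end, with the two lengths interchanged.\<close>

lemma agree_reverse: "agree n (\<lambda>(i, m). y (len (Suc n) - 1 - i, m)) = agree n y"
proof -
  have "(\<Sum>k<blk n. y (len (Suc n) - 1 - (len n + 2 * blk n + k), 0)) = (\<Sum>k<blk n. y (blk n - Suc k, 0))"
    by (intro sum.cong) (auto simp: len_Suc intro!: arg_cong[where f=y])
  also have "\<dots> = (\<Sum>k<blk n. y (k, 0))" by (rule sum.nat_diff_reindex)
  finally have 1: "block_positive (len n + 2 * blk n) (blk n) (\<lambda>(i, m). y (len (Suc n) - 1 - i, m)) = block_positive 0 (blk n) y"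
    by (simp add: block_positive_def)
  have "(\<Sum>k<blk n. y (len (Suc n) - 1 - k, 0)) = (\<Sum>k<blk n. y (len n + 2 * blk n + (blk n - Suc k), 0))"
    by (intro sum.cong) (auto simp: len_Suc intro!: arg_cong[where f=y])
  also have "\<dots> = (\<Sum>k<blk n. y (len n + 2 * blk n + k, 0))" by (rule sum.nat_diff_reindex)
  finally have 2: "block_positive 0 (blk n) (\<lambda>(i, m). y (len (Suc n) - 1 - i, m)) = block_positive (len n + 2 * blk n) (blk n) y"
    by (simp add: block_positive_def)
  show ?thesis unfolding agree_def 1 2 by auto
qed

lemma gauss_noise_bwd: "n \<le> N \<Longrightarrow> gauss_noise gauss_space (bwd N n)"
proof (induction n rule: inc_induct)
  case base
  have "inj (reversal (len N))" by (auto simp: inj_def reversal_def split: if_splits)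
  from gauss_noise_comp[OF gauss_noise_word gauss_noise_select_rows[OF this]]
  show ?case by (simp add: bwd_def[abs_def])
next
  case (step n)
  have eq: "bwd N n z = (\<lambda>y. select_rows (\<lambda>i. (if agree n y then blk n else 2 * blk n) + i) y) (bwd N (Suc n) z)" for z
  proof -
    have "agree n (bwd N (Suc n) z) = agree n (\<lambda>(i, m). word (Suc n) z (len (Suc n) - 1 - i, m))"
      using step(1,2) by (intro agree_cong) (simp add: bwd_inner)
    also have "\<dots> = coin n (word n z)" by (simp only: agree_reverse agree_word)
    finally have "3 * blk n - left n z = (if agree n (bwd N (Suc n) z) then blk n else 2 * blk n)"
      by (simp add: left_def offset_def)
    moreover have "nat (stop N z - stop n z) = (3 * blk n - left n z) + nat (stop N z - stop (Suc n) z)"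
      using stop_mono[of "Suc n" N z] step(1,2) by (simp add: stop_Suc nat_diff_distrib')
    ultimately show ?thesis
      by (simp add: bwd_def fun_eq_iff select_rows_def add_ac)
  qed
  have "gauss_noise gauss_space (\<lambda>z. (\<lambda>y. select_rows (\<lambda>i. (if agree n y then blk n else 2 * blk n) + i) y) (bwd N (Suc n) z))"
    by (rule gauss_noise_comp[OF step.IH gauss_noise_drop]) simp_all
  moreover have "bwd N n = (\<lambda>z. (\<lambda>y. select_rows (\<lambda>i. (if agree n y then blk n else 2 * blk n) + i) y) (bwd N (Suc n) z))"
    by (rule ext) (rule eq)
  ultimately show ?case by (simp only:)
qed

lemma gauss_noise_eta_forward:
  "gauss_noise gauss_space (\<lambda>z (i, m). eta z (start n z + int i) m)"
proof (rule gauss_noise_local)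
  fix J :: "(nat \<times> nat) set" assume "finite J"
  then obtain N0 where N0: "\<forall>i\<in>fst ` J. i < N0"
    using finite_nat_set_iff_bounded[of "fst ` J"] by auto
  \<comment> \<open>\<open>V N\<close> reaches at least \<open>N\<close> places to either side of
    the origin, enough for all places that \<open>J\<close> asks for.\<close>
  define N where "N = max n N0"
  have "eta z (start n z + int i) m = fwd N n z (i, m)" if "(i, m) \<in> J" for z i m
  proof -
    have "i < N" using N0 that by (force simp: N_def)
    then have "start N z \<le> start n z + int i" "start n z + int i < stop N z"
      using start_antimono[of n N z] start_le[of n z] stop_ge[of N z] by (auto simp: N_def)
    moreover have "nat (start n z + int i - start N z) = nat (start n z - start N z) + i"
      using start_antimono[of n N z] by (simp add: N_def)
    ultimately show ?thesis by (simp add: eta_eq fwd_def)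
  qed
  then show "\<exists>y'. gauss_noise gauss_space y' \<and>
      (\<forall>z\<in>space gauss_space. \<forall>j\<in>J. (case j of (i, m) \<Rightarrow> eta z (start n z + int i) m) = y' z j)"
    by (intro exI[of _ "fwd N n"]) (auto simp: gauss_noise_fwd N_def)
qed

lemma gauss_noise_eta_backward:
  "gauss_noise gauss_space (\<lambda>z (i, m). eta z (stop n z - 1 - int i) m)"
proof (rule gauss_noise_local)
  fix J :: "(nat \<times> nat) set" assume "finite J"
  then obtain N0 where N0: "\<forall>i\<in>fst ` J. i < N0"
    using finite_nat_set_iff_bounded[of "fst ` J"] by auto
  define N where "N = max n N0"
  have "eta z (stop n z - 1 - int i) m = bwd N n z (i, m)" if "(i, m) \<in> J" for z i m
  proof -
    have "i < N" using N0 that by (force simp: N_def)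
    then have b: "start N z \<le> stop n z - 1 - int i" "stop n z - 1 - int i < stop N z"
      using stop_mono[of n N z] start_le[of N z] stop_ge[of n z] by (auto simp: N_def)
    moreover have "nat (stop n z - 1 - int i - start N z) = reversal (len N) (nat (stop N z - stop n z) + i)"
      using b stop_mono[of n N z] by (auto simp: N_def reversal_def stop_def) linarith
    ultimately show ?thesis by (simp add: eta_eq bwd_def)
  qed
  then show "\<exists>y'. gauss_noise gauss_space y' \<and>
      (\<forall>z\<in>space gauss_space. \<forall>j\<in>J. (case j of (i, m) \<Rightarrow> eta z (stop n z - 1 - int i) m) = y' z j)"
    by (intro exI[of _ "bwd N n"]) (auto simp: gauss_noise_bwd N_def)
qed

section \<open>Levy's construction along a two-sided sequence of letters\<close>

text \<open>A letter is a sequence of independent normal variables whose entry \<open>0\<close> is the increment of the path.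
  Rotating all pairs of consecutive entries by 45 degrees splits it into the letters, rescaled by
  \<open>sqrt 2\<close>, of its two halves.\<close>

definition refine :: "(int \<Rightarrow> nat \<Rightarrow> real) \<Rightarrow> int \<Rightarrow> nat \<Rightarrow> real" where
  "refine z i m = (if even i then (z (i div 2) (2 * m) + z (i div 2) (2 * m + 1)) / sqrt 2
                   else (z (i div 2) (2 * m) - z (i div 2) (2 * m + 1)) / sqrt 2)"

text \<open>The one-sided form of \<open>refine\<close>. Read leftwards, the odd half of a letter
  comes before the even one, so the parity that receives the sum is a parameter: \<open>True\<close>
  for reading forwards, \<open>False\<close> for reading backwards.\<close>

definition refine_nat :: "bool \<Rightarrow> (nat \<times> nat \<Rightarrow> real) \<Rightarrow> nat \<times> nat \<Rightarrow> real" where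
  "refine_nat b y = (\<lambda>(k, m). if even k = b
     then (y (k div 2, 2 * m) + y (k div 2, 2 * m + 1)) / sqrt 2
     else (y (k div 2, 2 * m) - y (k div 2, 2 * m + 1)) / sqrt 2)"

lemma gauss_noise_refine_nat: "gauss_noise gauss_space (refine_nat b)"
proof -
  have "gauss_noise gauss_space (\<lambda>(y :: nat \<times> nat \<Rightarrow> real) (k :: nat \<times> nat). if even (fst k) = b
     then (y (fst (fst k div 2, snd k), 2 * snd (fst k div 2, snd k)) + y (fst (fst k div 2, snd k), 2 * snd (fst k div 2, snd k) + 1)) / sqrt 2
     else (y (fst (fst k div 2, snd k), 2 * snd (fst k div 2, snd k)) - y (fst (fst k div 2, snd k), 2 * snd (fst k div 2, snd k) + 1)) / sqrt 2)"
  proof (rule gauss_noise_refine[where f="\<lambda>p. (fst p, 2 * snd p)" and g="\<lambda>p. (fst p, 2 * snd p + 1)"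
        and e="\<lambda>k. (fst k div 2, snd k)" and c="\<lambda>k. even (fst k) = b"])
    fix k l :: "nat \<times> nat"
    assume "(fst k div 2, snd k) = (fst l div 2, snd l)"
      and "(even (fst k) = b) = (even (fst l) = b)"
    then have "fst k div 2 = fst l div 2" "even (fst k) = even (fst l)" "snd k = snd l"
      by auto
    then show "k = l"
      by (metis prod_eq_iff div_mult_mod_eq parity_cases even_iff_mod_2_eq_zero odd_iff_mod_2_eq_one)
  next
    show "(fst i, 2 * snd i) \<noteq> (fst j, 2 * snd j + 1)" for i j :: "nat \<times> nat"
      by simp presburger
  qed (auto simp: inj_def prod_eq_iff)
  then show ?thesis
    by (simp add: refine_nat_def[abs_def] case_prod_unfold cong: if_cong)
qed

primrec level :: "nat \<Rightarrow> (int \<Rightarrow> nat \<Rightarrow> real) \<Rightarrow> int \<Rightarrow> nat \<Rightarrow> real" where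
  "level 0 z = z"
| "level (Suc N) z = refine (level N z)"

primrec level_nat :: "bool \<Rightarrow> nat \<Rightarrow> (nat \<times> nat \<Rightarrow> real) \<Rightarrow> nat \<times> nat \<Rightarrow> real" where
  "level_nat b 0 y = y"
| "level_nat b (Suc N) y = refine_nat b (level_nat b N y)"

lemma gauss_noise_level_nat: "gauss_noise gauss_space (level_nat b N)"
proof (induction N)
  case 0
  show ?case using gauss_noise_reindex[of "\<lambda>i. i"] by (simp add: level_nat.simps(1)[abs_def])
next
  case (Suc N)
  have "level_nat b (Suc N) = (\<lambda>y. refine_nat b (level_nat b N y))" by (simp add: fun_eq_iff)
  then show ?case using gauss_noise_comp[OF Suc gauss_noise_refine_nat] by simp
qed

lemma level_forward:
  "level N z (2 ^ N * s + int k) m = level_nat True N (\<lambda>(i, m). z (s + int i) m) (k, m)"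
proof (induction N arbitrary: k m)
  case (Suc N)
  have 1: "(2 ^ Suc N * s + int k) div 2 = 2 ^ N * s + int (k div 2)"
    by (simp add: mult.assoc zdiv_int)
  have 2: "even (2 ^ Suc N * s + int k) = even k" by simp
  show ?case unfolding level.simps level_nat.simps refine_def refine_nat_def 1 2 Suc.IH
    by simp
qed simp

lemma level_backward:
  "level N z (2 ^ N * s - 1 - int k) m = level_nat False N (\<lambda>(i, m). z (s - 1 - int i) m) (k, m)"
proof (induction N arbitrary: k m)
  case (Suc N)
  have 1: "(2 ^ Suc N * s - 1 - int k) div 2 = 2 ^ N * s - 1 - int (k div 2)"
  proof -
    have "(2 * (2 ^ N * s) - 1 - int k) div 2 = 2 ^ N * s - 1 - int k div 2" by presburger
    then show ?thesis by (simp add: mult.assoc zdiv_int)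
  qed
  have 2: "even (2 ^ Suc N * s - 1 - int k) = (\<not> even k)" by simp
  show ?case unfolding level.simps level_nat.simps refine_def refine_nat_def 1 2 Suc.IH
    by simp
qed simp

text \<open>The increment of the path over the dyadic interval from \<open>i / 2 ^ N\<close> to
  \<open>(i + 1) / 2 ^ N\<close>: entry 0 of a letter of level \<open>N\<close>, scaled to the
  standard deviation of that interval.\<close>

definition inc :: "nat \<Rightarrow> (int \<Rightarrow> nat \<Rightarrow> real) \<Rightarrow> int \<Rightarrow> real" where
  "inc N z i = level N z i 0 / sqrt (2 ^ N)"

lemma inc_split: "inc (Suc N) z (2 * i) + inc (Suc N) z (2 * i + 1) = inc N z i"
proof -
  have "inc (Suc N) z (2 * i) + inc (Suc N) z (2 * i + 1)
    = 2 * level N z i 0 / (sqrt 2 * sqrt (2 ^ Suc N))"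
    by (simp add: inc_def refine_def add_divide_distrib[symmetric])
  also have "sqrt 2 * sqrt (2 ^ Suc N) = 2 * sqrt (2 ^ N)" by (simp add: real_sqrt_mult)
  finally show ?thesis by (simp add: inc_def)
qed

section \<open>The path as a limit of partial sums\<close>

definition psum :: "(int \<Rightarrow> real) \<Rightarrow> int \<Rightarrow> real" where
  "psum g k = (\<Sum>i\<in>{0..<k}. g i) - (\<Sum>i\<in>{k..<0}. g i)"

lemma psum_0[simp]: "psum g 0 = 0" by (simp add: psum_def)

lemma psum_plus1: "psum g (k + 1) = psum g k + g k"
proof (cases "0 \<le> k")
  case True
  then have "{0..<k + 1} = insert k {0..<k}" "{k..<0} = {}" "{k+1..<0} = {}" by auto
  then show ?thesis by (simp add: psum_def)
next
  case False
  then have "{k..<0} = insert k {k+1..<0}" "{0..<k} = {}" "{0..<k+1} = {}" by auto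
  then show ?thesis by (simp add: psum_def)
qed

lemma psum_inc_double: "psum (inc (Suc N) z) (2 * k) = psum (inc N z) k"
proof (induction k rule: int_induct[where k=0])
  case (step1 k)
  have "psum (inc (Suc N) z) (2 * (k + 1)) = psum (inc (Suc N) z) ((2 * k + 1) + 1)" 
    by (simp add: algebra_simps)
  also have "\<dots> = psum (inc N z) k + inc N z k"
    unfolding psum_plus1 using step1 inc_split[of N z k] by simp
  finally show ?case by (simp add: psum_plus1)
next
  case (step2 k)
  have "psum (inc (Suc N) z) (2 * k) = psum (inc (Suc N) z) (2 * (k - 1)) + inc N z (k - 1)"
    using psum_plus1[of "inc (Suc N) z" "2 * (k - 1) + 1"] psum_plus1[of "inc (Suc N) z" "2 * (k - 1)"]
      inc_split[of N z "k - 1"] by (simp add: algebra_simps)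
  moreover have "psum (inc N z) k = psum (inc N z) (k - 1) + inc N z (k - 1)"
    using psum_plus1[of "inc N z" "k - 1"] by simp
  ultimately show ?case using step2 by simp
qed simp

lemma psum_inc_power: "psum (inc (N + d) z) (k * 2 ^ d) = psum (inc N z) k"
proof (induction d)
  case (Suc d)
  have "psum (inc (N + Suc d) z) (k * 2 ^ Suc d) = psum (inc (Suc (N + d)) z) (2 * (k * 2 ^ d))"
    by (simp add: mult_ac)
  then show ?case using Suc psum_inc_double by simp
qed simp

definition approx :: "nat \<Rightarrow> (int \<Rightarrow> nat \<Rightarrow> real) \<Rightarrow> real \<Rightarrow> real" where
  "approx N z t = psum (inc N z) \<lfloor>t * 2 ^ N\<rfloor>"

text \<open>At a dyadic time the approximations are eventually constant, so the value is the
  intended one for every sample. At other times the limit may fail to exist and \<open>lim\<close>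
  is then unspecified; for tame letters this does not happen.\<close>

definition trajectory :: "(int \<Rightarrow> nat \<Rightarrow> real) \<Rightarrow> real \<Rightarrow> real" where
  "trajectory z t = lim (\<lambda>N. approx N z t)"

lemma trajectory_dyadic: "trajectory z (of_int k / 2 ^ N) = psum (inc N z) k"
proof -
  have "approx (d + N) z (of_int k / 2 ^ N) = psum (inc N z) k" for d
  proof -
    have "of_int k / 2 ^ N * (2::real) ^ (d + N) = of_int (k * 2 ^ d)"
      by (simp add: power_add)
    then show ?thesis unfolding approx_def by (simp only: floor_of_int add.commute[of d] psum_inc_power)
  qed
  then have "(\<lambda>d. approx (d + N) z (of_int k / 2 ^ N)) \<longlonglongrightarrow> psum (inc N z) k" by simp
  then have "(\<lambda>d. approx d z (of_int k / 2 ^ N)) \<longlonglongrightarrow> psum (inc N z) k"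
    by (rule LIMSEQ_offset)
  then show ?thesis unfolding trajectory_def by (rule limI)
qed

lemma trajectory_int: "trajectory z (of_int k) = psum (\<lambda>i. z i 0) k"
  using trajectory_dyadic[of z k 0] by (simp add: inc_def[abs_def])

lemma trajectory_dyadic_diff:
  "trajectory z (of_int (k + 1) / 2 ^ N) - trajectory z (of_int k / 2 ^ N) = inc N z k"
  unfolding trajectory_dyadic psum_plus1 by simp

section \<open>Continuity of the path\<close>

lemma geometric_limit:
  fixes x :: "nat \<Rightarrow> real"
  assumes step: "\<And>N. N0 \<le> N \<Longrightarrow> \<bar>x (Suc N) - x N\<bar> \<le> C * (9/10) ^ N"
  shows "convergent x" and "N0 \<le> N \<Longrightarrow> \<bar>lim x - x N\<bar> \<le> 10 * C * (9/10) ^ N"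
proof -
  have *: "\<exists>y. x \<longlonglongrightarrow> y \<and> \<bar>y - x N\<bar> \<le> 10 * C * (9/10) ^ N" if "N0 \<le> N" for N
  proof -
    define d where "d i = x (Suc (i + N)) - x (i + N)" for i
    have db: "norm (d i) \<le> C * (9/10) ^ N * (9/10) ^ i" for i
      using step[of "i + N"] that by (simp add: d_def power_add mult_ac)
    have sg: "(\<lambda>i. C * (9/10) ^ N * (9/10) ^ i) sums (C * (9/10) ^ N * (1 / (1 - 9/10)))"
      by (intro sums_mult geometric_sums) simp
    have sd: "summable d"
      by (rule summable_comparison_test'[OF sums_summable[OF sg] db])
    have "(\<lambda>n. \<Sum>i<n. d i) \<longlonglongrightarrow> suminf d" using sd by (rule summable_LIMSEQ)
    moreover have "(\<Sum>i<n. d i) = x (n + N) - x N" for n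
      unfolding d_def using sum_lessThan_telescope[of "\<lambda>i. x (i + N)" n] by simp
    ultimately have "(\<lambda>n. x (n + N) - x N + x N) \<longlonglongrightarrow> suminf d + x N"
      by (intro tendsto_add tendsto_const) simp
    then have "x \<longlonglongrightarrow> suminf d + x N"
      using LIMSEQ_offset[of x N] by simp
    moreover have "\<bar>suminf d\<bar> \<le> C * (9/10) ^ N * (1 / (1 - 9/10))"
      using norm_suminf_le[of d "\<lambda>i. C * (9/10) ^ N * (9/10) ^ i"] db sg by (simp add: sums_iff)
    ultimately show ?thesis by (intro exI[of _ "suminf d + x N"]) simp
  qed
  from *[of N0] show "convergent x" by (auto simp: convergent_def)
  show "\<bar>lim x - x N\<bar> \<le> 10 * C * (9/10) ^ N" if "N0 \<le> N"
    using *[OF that] limI by auto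
qed

text \<open>The ratio \<open>9/10\<close> is a choice between \<open>2 powr (-1/4)\<close> and 1.
  The lower limit comes from the fourth moment: about \<open>2 ^ N\<close> increments exceed
  \<open>r ^ N\<close> with probability of order \<open>1 / (4 * r ^ 4) ^ N\<close> each, which is
  summable only if \<open>2 * r ^ 4 > 1\<close>.\<close>

definition tame :: "(int \<Rightarrow> nat \<Rightarrow> real) \<Rightarrow> bool" where
  "tame z \<longleftrightarrow> (\<forall>K::nat. \<exists>N0. \<forall>N\<ge>N0. \<forall>i. \<bar>i\<bar> \<le> int K * 2 ^ N \<longrightarrow> \<bar>inc N z i\<bar> \<le> (9/10) ^ N)"

text \<open>Rounding down to the next finer grid moves the grid point by at most one fine step, so
  successive approximations differ by at most one increment.\<close>

lemma floor_double: "\<lfloor>2 * x\<rfloor> = 2 * \<lfloor>x\<rfloor> \<or> \<lfloor>2 * x\<rfloor> = 2 * \<lfloor>x\<rfloor> + (1::int)" for x :: real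
  by linarith

lemma continuous_trajectory:
  assumes "tame z"
  shows "continuous_on UNIV (trajectory z)"
proof -
  have "isCont (trajectory z) t" for t
    unfolding continuous_at_eps_delta
  proof (intro allI impI)
    fix e :: real assume e: "0 < e"
    obtain K :: nat where K: "\<bar>t\<bar> + 2 \<le> real K" using real_arch_simple by blast
    obtain N0 where N0: "\<And>N i. N \<ge> N0 \<Longrightarrow> \<bar>i\<bar> \<le> int K * 2 ^ N \<Longrightarrow> \<bar>inc N z i\<bar> \<le> (9/10) ^ N"
      using assms unfolding tame_def by metis
    have fl: "\<bar>\<lfloor>s * 2 ^ N\<rfloor>\<bar> \<le> int K * 2 ^ N" if "\<bar>s\<bar> \<le> real K" for s N
    proof -
      have "\<bar>s * 2 ^ N\<bar> \<le> real K * 2 ^ N" using that by (simp add: abs_mult)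
      also have "\<dots> = of_int (int K * 2 ^ N)" by simp
      finally have *: "s * 2 ^ N \<le> of_int (int K * 2 ^ N)" "of_int (- (int K * 2 ^ N)) \<le> s * 2 ^ N"
        by (simp_all add: abs_le_iff)
      have "\<lfloor>s * 2 ^ N\<rfloor> \<le> int K * 2 ^ N" using floor_mono[OF *(1)] by (simp only: floor_of_int)
      moreover have "- (int K * 2 ^ N) \<le> \<lfloor>s * 2 ^ N\<rfloor>" using floor_mono[OF *(2)] by (simp only: floor_of_int)
      ultimately show ?thesis by simp
    qed
    have st: "\<bar>approx (Suc N) z s - approx N z s\<bar> \<le> 1 * (9/10) ^ N" if s: "\<bar>s\<bar> \<le> real K" and N: "N0 \<le> N" for s N
    proof -
      have *: "s * 2 ^ Suc N = 2 * (s * 2 ^ N)" by simp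
      have "\<bar>2 * \<lfloor>s * 2 ^ N\<rfloor>\<bar> \<le> int K * 2 ^ Suc N" using fl[OF s, of N] by simp
      then have "\<bar>inc (Suc N) z (2 * \<lfloor>s * 2 ^ N\<rfloor>)\<bar> \<le> (9/10) ^ Suc N" using N by (intro N0) auto
      also have "\<dots> \<le> (9/10) ^ N" by simp
      finally have "\<bar>inc (Suc N) z (2 * \<lfloor>s * 2 ^ N\<rfloor>)\<bar> \<le> (9/10) ^ N" .
      then show ?thesis
        using floor_double[of "s * 2 ^ N"] unfolding approx_def *
        by (auto simp: psum_inc_double psum_plus1 simp del: power_Suc)
    qed
    have cl: "\<bar>trajectory z s - approx N z s\<bar> \<le> 10 * (9/10) ^ N" if s: "\<bar>s\<bar> \<le> real K" and N: "N0 \<le> N" for s N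
      using geometric_limit(2)[OF st[OF s] N] by (simp add: trajectory_def)
    \<comment> \<open>Two approximation errors of at most \<open>10 * (9/10) ^ N\<close>, and one
      increment between neighbouring grid points.\<close>
    have "(\<lambda>N. 21 * (9/10::real) ^ N) \<longlonglongrightarrow> 21 * 0" by (intro tendsto_intros LIMSEQ_power_zero) simp
    then have "eventually (\<lambda>N. 21 * (9/10::real) ^ N < e) sequentially" using e by (intro order_tendstoD) auto
    then obtain N1 where N1: "\<And>N. N \<ge> N1 \<Longrightarrow> 21 * (9/10::real) ^ N < e" by (auto simp: eventually_sequentially)
    define N where "N = max N0 N1"
    show "\<exists>d>0. \<forall>s. dist s t < d \<longrightarrow> dist (trajectory z s) (trajectory z t) < e"
    proof (intro exI[of _ "1 / 2 ^ N"] conjI allI impI)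
      fix s assume "dist s t < 1 / 2 ^ N"
      then have d: "\<bar>s - t\<bar> < 1 / 2 ^ N" by (simp add: dist_real_def)
      have "(1::real) / 2 ^ N \<le> 1" by simp
      then have sK: "\<bar>s\<bar> \<le> real K" and tK: "\<bar>t\<bar> \<le> real K" using d K by linarith+
      have "\<bar>s * 2 ^ N - t * 2 ^ N\<bar> < 1"
      proof -
        have "\<bar>s * 2 ^ N - t * 2 ^ N\<bar> = \<bar>s - t\<bar> * 2 ^ N"
          unfolding left_diff_distrib[symmetric] abs_mult by simp
        then show ?thesis using d by (simp add: pos_less_divide_eq)
      qed
      then have "\<lfloor>s * 2 ^ N\<rfloor> = \<lfloor>t * 2 ^ N\<rfloor> \<or> \<lfloor>s * 2 ^ N\<rfloor> = \<lfloor>t * 2 ^ N\<rfloor> + 1 \<or> \<lfloor>t * 2 ^ N\<rfloor> = \<lfloor>s * 2 ^ N\<rfloor> + 1"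
        by linarith
      moreover have "\<bar>inc N z \<lfloor>s * 2 ^ N\<rfloor>\<bar> \<le> (9/10) ^ N" "\<bar>inc N z \<lfloor>t * 2 ^ N\<rfloor>\<bar> \<le> (9/10) ^ N"
        by (rule N0; use fl sK tK in \<open>simp add: N_def\<close>)+
      ultimately have "\<bar>approx N z s - approx N z t\<bar> \<le> (9/10) ^ N"
        by (auto simp: approx_def psum_plus1)
      moreover have "21 * (9/10) ^ N < e" by (rule N1) (simp add: N_def)
      moreover have "N0 \<le> N" by (simp add: N_def)
      ultimately show "dist (trajectory z s) (trajectory z t) < e"
        using cl[OF sK, of N] cl[OF tK, of N] unfolding dist_real_def by linarith
    qed simp
  qed
  then show ?thesis by (simp add: continuous_at_imp_continuous_on)
qed

section \<open>Forward and backward Brownian motion\<close>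

text \<open>Markov's inequality for the fourth power; 3 is the fourth moment of a standard normal
  variable. Second moments would be too weak to be summed over the \<open>2 ^ N\<close> increments
  of a level.\<close>

lemma (in prob_space) normal_tail:
  assumes X: "distributed M lborel X (normal_density 0 \<sigma>)" and \<sigma>: "0 < \<sigma>" and c: "0 < c"
  shows "prob {\<omega>\<in>space M. c < \<bar>X \<omega>\<bar>} \<le> 3 * \<sigma> ^ 4 / c ^ 4"
proof -
  define Z where "Z \<omega> = X \<omega> / \<sigma>" for \<omega>
  have Z: "distributed M lborel Z std_normal_density"
    using X unfolding normal_standard_normal_convert[OF \<sigma>] by (simp add: Z_def[abs_def])
  have [measurable]: "Z \<in> borel_measurable M" using distributed_measurable[OF Z] by simp
  have m4: "has_bochner_integral lborel (\<lambda>x. std_normal_density x * x ^ 4) 3"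
    using std_normal_moment_even[of 2] by (simp add: fact_numeral)
  have E: "expectation (\<lambda>\<omega>. Z \<omega> ^ 4) = 3"
    using distributed_integral[OF Z, of "\<lambda>x. x ^ 4"] has_bochner_integral_integral_eq[OF m4] by simp
  have I: "integrable M (\<lambda>\<omega>. Z \<omega> ^ 4)"
    using distributed_integrable[OF Z, of "\<lambda>x. x ^ 4"] m4 by (simp add: has_bochner_integral_iff)
  have "{\<omega>\<in>space M. c < \<bar>X \<omega>\<bar>} \<subseteq> {\<omega>\<in>space M. (c / \<sigma>) ^ 4 \<le> Z \<omega> ^ 4}"
  proof safe
    fix \<omega> assume "c < \<bar>X \<omega>\<bar>"
    then have "c / \<sigma> \<le> \<bar>Z \<omega>\<bar>" using \<sigma> by (simp add: Z_def divide_right_mono)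
    then have "(c / \<sigma>) ^ 4 \<le> \<bar>Z \<omega>\<bar> ^ 4" using c \<sigma> by (intro power_mono) auto
    then show "(c / \<sigma>) ^ 4 \<le> Z \<omega> ^ 4" by (simp add: power_even_abs)
  qed
  then have "prob {\<omega>\<in>space M. c < \<bar>X \<omega>\<bar>} \<le> prob {\<omega>\<in>space M. (c / \<sigma>) ^ 4 \<le> Z \<omega> ^ 4}"
    by (intro finite_measure_mono) measurable
  also have "\<dots> \<le> expectation (\<lambda>\<omega>. Z \<omega> ^ 4) / (c / \<sigma>) ^ 4"
    by (rule integral_Markov_inequality_measure[OF I sets.top]) (use c \<sigma> in auto)
  also have "\<dots> = 3 * \<sigma> ^ 4 / c ^ 4" by (simp add: E power_divide)
  finally show ?thesis .
qed

lemma measurable_word: "word n \<in> gauss_space \<rightarrow>\<^sub>M gauss_space"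
  using gauss_noise_word by (simp add: gauss_noise_def)

lemma measurable_start: "start n \<in> gauss_space \<rightarrow>\<^sub>M count_space UNIV"
proof (induction n)
  case (Suc n)
  have [measurable]: "Measurable.pred gauss_space (\<lambda>z. coin n (word n z))"
    by (rule measurable_compose[OF measurable_word coin_measurable])
  have [measurable]: "(\<lambda>z. start n z - int c) \<in> gauss_space \<rightarrow>\<^sub>M count_space UNIV" for c
    by (rule measurable_compose[OF Suc]) simp
  have "start (Suc n) = (\<lambda>z. if coin n (word n z) then start n z - int (2 * blk n) else start n z - int (blk n))"
    by (auto simp: fun_eq_iff start.simps(2) left_def offset_def)
  moreover have "(\<lambda>z. if coin n (word n z) then start n z - int (2 * blk n) else start n z - int (blk n)) \<in> gauss_space \<rightarrow>\<^sub>M count_space UNIV"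
    by measurable
  ultimately show ?case by (simp only:)
qed (simp add: start.simps(1)[abs_def])

lemma measurable_stop: "stop n \<in> gauss_space \<rightarrow>\<^sub>M count_space UNIV"
  unfolding stop_def[abs_def] by (rule measurable_compose[OF measurable_start]) simp

section \<open>The process driven by a given noise\<close>

locale noise_source = prob_space M for M :: "'a measure" +
  fixes z :: "'a \<Rightarrow> nat \<times> nat \<Rightarrow> real"
  assumes z: "gauss_noise M z"
begin

definition X :: "real \<Rightarrow> 'a \<Rightarrow> real" where
  "X t \<omega> = trajectory (eta (z \<omega>)) t"

lemma noise_forward:
  "gauss_noise M (\<lambda>\<omega> k. level N (eta (z \<omega>)) (2 ^ N * start n (z \<omega>) + int k) 0)"
proof -
  have "gauss_noise M (\<lambda>\<omega>. level_nat True N (\<lambda>(i, m). eta (z \<omega>) (start n (z \<omega>) + int i) m))"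
    by (rule gauss_noise_comp[OF gauss_noise_comp[OF z gauss_noise_eta_forward] gauss_noise_level_nat])
  moreover have "gauss_noise gauss_space (\<lambda>(y :: nat \<times> nat \<Rightarrow> real) k. y (k, 0))"
    by (rule gauss_noise_reindex) (simp add: inj_def)
  ultimately show ?thesis
    unfolding level_forward by (rule gauss_noise_comp)
qed

lemma noise_backward:
  "gauss_noise M (\<lambda>\<omega> k. - level N (eta (z \<omega>)) (2 ^ N * stop n (z \<omega>) - 1 - int k) 0)"
proof -
  have "gauss_noise M (\<lambda>\<omega>. level_nat False N (\<lambda>(i, m). eta (z \<omega>) (stop n (z \<omega>) - 1 - int i) m))"
    by (rule gauss_noise_comp[OF gauss_noise_comp[OF z gauss_noise_eta_backward] gauss_noise_level_nat])
  moreover have "gauss_noise gauss_space (\<lambda>(y :: nat \<times> nat \<Rightarrow> real) k. y (k, 0))"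
    by (rule gauss_noise_reindex) (simp add: inj_def)
  ultimately have "gauss_noise M (\<lambda>\<omega> k. level_nat False N (\<lambda>(i, m). eta (z \<omega>) (stop n (z \<omega>) - 1 - int i) m) (k, 0))"
    by (rule gauss_noise_comp)
  from gauss_noise_comp[OF this gauss_noise_sign[of "\<lambda>_. -1"]]
  show ?thesis unfolding level_backward by simp
qed

text \<open>\<open>V 0\<close> is empty and sits at the origin, so the noises that start at its two
  ends cover all nonnegative and all negative places. The backward noise carries a minus sign, which
  the absolute value absorbs.\<close>

lemma level_tail:
  assumes "0 < c"
  shows "(\<lambda>\<omega>. level N (eta (z \<omega>)) i 0) \<in> borel_measurable M"
    and "prob {\<omega>\<in>space M. c < \<bar>level N (eta (z \<omega>)) i 0\<bar>} \<le> 3 / c ^ 4"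
proof -
  have "\<exists>s Y. (s = 1 \<or> s = -1) \<and> distributed M lborel Y std_normal_density \<and> (\<forall>\<omega>. level N (eta (z \<omega>)) i 0 = s * Y \<omega>)"
  proof (cases "0 \<le> i")
    case True
    have "2 ^ N * start 0 (z \<omega>) + int (nat i) = i" for \<omega> using True by simp
    then have "distributed M lborel (\<lambda>\<omega>. level N (eta (z \<omega>)) i 0) std_normal_density"
      using gauss_noise_indep(2)[OF prob_space_axioms noise_forward[of N 0], of "nat i"] by simp
    then show ?thesis by (intro exI[of _ 1]) auto
  next
    case False
    have "2 ^ N * stop 0 (z \<omega>) - 1 - int (nat (- i - 1)) = i" for \<omega> using False by simp
    then have "distributed M lborel (\<lambda>\<omega>. - level N (eta (z \<omega>)) i 0) std_normal_density"
      using gauss_noise_indep(2)[OF prob_space_axioms noise_backward[of N 0], of "nat (- i - 1)"] by simp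
    then show ?thesis by (intro exI[of _ "-1"] exI[of _ "\<lambda>\<omega>. - level N (eta (z \<omega>)) i 0"]) auto
  qed
  then obtain s Y where s: "s = 1 \<or> s = -1" and Y: "distributed M lborel Y std_normal_density"
    and eq: "\<And>\<omega>. level N (eta (z \<omega>)) i 0 = s * Y \<omega>" by auto
  have "Y \<in> borel_measurable M" using distributed_measurable[OF Y] by simp
  then show "(\<lambda>\<omega>. level N (eta (z \<omega>)) i 0) \<in> borel_measurable M"
    unfolding eq by simp
  show "prob {\<omega>\<in>space M. c < \<bar>level N (eta (z \<omega>)) i 0\<bar>} \<le> 3 / c ^ 4"
    using normal_tail[OF Y _ assms] s unfolding eq by (auto simp: abs_mult)
qed

lemma inc_measurable[measurable]: "(\<lambda>\<omega>. inc N (eta (z \<omega>)) i) \<in> borel_measurable M"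
  using level_tail(1)[of 1 N i] by (simp add: inc_def)

lemma X_measurable: "X t \<in> borel_measurable M"
  unfolding X_def[abs_def] trajectory_def
proof (rule borel_measurable_lim_metric)
  show "(\<lambda>\<omega>. approx N (eta (z \<omega>)) t) \<in> borel_measurable M" for N
    unfolding approx_def psum_def by measurable
qed

lemma AE_tame: "AE \<omega> in M. tame (eta (z \<omega>))"
proof -
  have "AE \<omega> in M. \<exists>N0. \<forall>N\<ge>N0. \<forall>i. \<bar>i\<bar> \<le> int K * 2 ^ N \<longrightarrow> \<bar>inc N (eta (z \<omega>)) i\<bar> \<le> (9/10) ^ N" for K :: nat
  proof -
    define I where "I N = {- (int K * 2 ^ N)..int K * 2 ^ N}" for N
    define A where "A N = (\<Union>i\<in>I N. {\<omega>\<in>space M. (9/10) ^ N < \<bar>inc N (eta (z \<omega>)) i\<bar>})" for N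
    have A1[measurable]: "{\<omega>\<in>space M. (9/10) ^ N < \<bar>inc N (eta (z \<omega>)) i\<bar>} \<in> sets M" for N i
      by measurable
    then have A[measurable]: "A N \<in> sets M" for N
      unfolding A_def I_def by (intro sets.finite_UN) auto
    have fin: "finite (I N)" for N by (simp add: I_def)
    \<comment> \<open>The fourth power of \<open>(9/10) ^ N\<close> times the square root of
      \<open>2 ^ N\<close> is the inverse of \<open>q ^ N\<close>. Since \<open>2 * q < 1\<close>,
      the factor \<open>2 ^ N\<close> for the number of increments is affordable and Borel-Cantelli
      applies.\<close>
    define q :: real where "q = 1 / (4 * (9/10) ^ 4)"
    have cN: "card (I N) \<le> (2 * K + 1) * 2 ^ N" for N
    proof -
      have "int (card (I N)) = 2 * (int K * 2 ^ N) + 1" by (simp add: I_def)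
      also have "\<dots> \<le> 2 * (int K * 2 ^ N) + 2 ^ N" by simp
      also have "\<dots> = int ((2 * K + 1) * 2 ^ N)" by (simp add: algebra_simps)
      finally show ?thesis by (simp only: of_nat_le_iff)
    qed
    have pA: "prob (A N) \<le> (2 * real K + 1) * 3 * (2 * q) ^ N" for N
    proof -
      have e: "prob {\<omega>\<in>space M. (9/10) ^ N < \<bar>inc N (eta (z \<omega>)) i\<bar>} \<le> 3 * q ^ N" for i
      proof -
        have c: "0 < (9/10) ^ N * sqrt (2 ^ N)" by simp
        have "{\<omega>\<in>space M. (9/10) ^ N < \<bar>inc N (eta (z \<omega>)) i\<bar>} = {\<omega>\<in>space M. (9/10) ^ N * sqrt (2 ^ N) < \<bar>level N (eta (z \<omega>)) i 0\<bar>}"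
          by (auto simp: inc_def pos_less_divide_eq)
        then have "prob {\<omega>\<in>space M. (9/10) ^ N < \<bar>inc N (eta (z \<omega>)) i\<bar>} \<le> 3 / ((9/10) ^ N * sqrt (2 ^ N)) ^ 4"
          using level_tail(2)[OF c, of N i] by simp
        also have "((9/10) ^ N * sqrt (2 ^ N)) ^ 4 = (4 * (9/10::real) ^ 4) ^ N"
        proof -
          have "sqrt (2 ^ N) ^ 4 = (sqrt (2 ^ N) * sqrt (2 ^ N)) * (sqrt (2 ^ N) * sqrt (2 ^ N))"
            by (simp only: power4_eq_xxxx mult.assoc)
          also have "\<dots> = (2 ^ N) * (2 ^ N)" by simp
          also have "\<dots> = (4::real) ^ N" by (simp flip: power_mult_distrib)
          finally have 4: "sqrt (2 ^ N) ^ 4 = (4::real) ^ N" .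
          have "((9/10) ^ N) ^ 4 = ((9/10::real) ^ 4) ^ N" by (simp only: power_mult[symmetric] mult.commute)
          then show ?thesis unfolding power_mult_distrib 4 by (simp only: mult.commute)
        qed
        also have "3 / (4 * (9/10::real) ^ 4) ^ N = 3 * q ^ N" by (simp add: q_def power_divide)
        finally show ?thesis .
      qed
      have "prob (A N) \<le> (\<Sum>i\<in>I N. prob {\<omega>\<in>space M. (9/10) ^ N < \<bar>inc N (eta (z \<omega>)) i\<bar>})"
        unfolding A_def by (rule finite_measure_subadditive_finite[OF fin]) auto
      also have "\<dots> \<le> (\<Sum>i\<in>I N. 3 * q ^ N)" by (intro sum_mono e)
      also have "\<dots> = real (card (I N)) * (3 * q ^ N)" by simp
      also have "\<dots> \<le> real ((2 * K + 1) * 2 ^ N) * (3 * q ^ N)"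
        using cN[of N] by (intro mult_right_mono) (simp_all only: of_nat_le_iff, simp add: q_def)
      also have "\<dots> = (2 * real K + 1) * 3 * (2 * q) ^ N" by (simp add: power_mult_distrib algebra_simps)
      finally show ?thesis .
    qed
    have "summable (\<lambda>N. (2 * real K + 1) * 3 * (2 * q) ^ N)"
      by (intro summable_mult summable_geometric) (simp add: q_def power4_eq_xxxx)
    then have "summable (\<lambda>N. prob (A N))"
      by (rule summable_comparison_test') (use pA in auto)
    then have "AE \<omega> in M. eventually (\<lambda>N. \<omega> \<in> space M - A N) sequentially"
      by (intro borel_cantelli_AE1) (auto simp: emeasure_eq_measure)
    then show ?thesis
    proof eventually_elim
      case (elim \<omega>)
      then obtain N0 where N0: "\<And>N. N \<ge> N0 \<Longrightarrow> \<omega> \<in> space M - A N" by (auto simp: eventually_sequentially)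
      have "\<bar>inc N (eta (z \<omega>)) i\<bar> \<le> (9/10) ^ N" if "N \<ge> N0" "\<bar>i\<bar> \<le> int K * 2 ^ N" for N i
      proof -
        have "i \<in> I N" using that(2) by (auto simp: I_def abs_le_iff)
        then show ?thesis using N0[OF that(1)] unfolding A_def by (auto simp: not_less)
      qed
      then show ?case by blast
    qed
  qed
  then show ?thesis unfolding tame_def by (subst AE_all_countable) auto
qed

lemma AE_continuous: "AE \<omega> in M. continuous_on UNIV (\<lambda>t. X t \<omega>)"
  using AE_tame by eventually_elim (simp add: X_def continuous_trajectory)

text \<open>As the random time takes integer values, this is a countable case distinction and needs
  no joint measurability of the process.\<close>

lemma X_shift_measurable:
  assumes "T \<in> M \<rightarrow>\<^sub>M count_space UNIV"
  shows "(\<lambda>\<omega>. X (of_int (T \<omega>) + t) \<omega>) \<in> borel_measurable M"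
  by (rule measurable_compose_countable[OF X_measurable assms])

lemma z_measurable: "z \<in> M \<rightarrow>\<^sub>M gauss_space"
  using z by (simp add: gauss_noise_def)

lemma standard_BM_forward:
  "standard_BM (\<lambda>t \<omega>. X (of_int (start n (z \<omega>)) + t) \<omega> - X (of_int (start n (z \<omega>))) \<omega>)"
proof (rule standard_BM_dyadicI[OF _ _ _ noise_forward[of _ n]])
  have T: "(\<lambda>\<omega>. start n (z \<omega>)) \<in> M \<rightarrow>\<^sub>M count_space UNIV"
    by (rule measurable_compose[OF z_measurable measurable_start])
  show "(\<lambda>\<omega>. X (of_int (start n (z \<omega>)) + t) \<omega> - X (of_int (start n (z \<omega>))) \<omega>) \<in> borel_measurable M" for t
    using X_shift_measurable[OF T, of t] X_shift_measurable[OF T, of 0] by simp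
  show "AE \<omega> in M. continuous_on {0..} (\<lambda>t. X (of_int (start n (z \<omega>)) + t) \<omega> - X (of_int (start n (z \<omega>))) \<omega>)"
    using AE_continuous
  proof eventually_elim
    case (elim \<omega>)
    have "continuous_on {0..} (\<lambda>t. X (of_int (start n (z \<omega>)) + t) \<omega>)"
      by (rule continuous_on_compose2[OF elim]) (auto intro: continuous_on_add continuous_on_diff continuous_on_const continuous_on_id)
    then show ?case by (intro continuous_on_diff continuous_on_const)
  qed
  fix N k \<omega>
  have "real_of_int (start n (z \<omega>)) + real j / 2 ^ N = of_int (2 ^ N * start n (z \<omega>) + int j) / 2 ^ N" for j
    by (simp add: add_divide_distrib)
  then show "X (of_int (start n (z \<omega>)) + real (Suc k) / 2 ^ N) \<omega> - X (of_int (start n (z \<omega>))) \<omega> -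
    (X (of_int (start n (z \<omega>)) + real k / 2 ^ N) \<omega> - X (of_int (start n (z \<omega>))) \<omega>)
    = level N (eta (z \<omega>)) (2 ^ N * start n (z \<omega>) + int k) 0 / sqrt (2 ^ N)"
    using trajectory_dyadic_diff[of "eta (z \<omega>)" "2 ^ N * start n (z \<omega>) + int k" N]
    by (simp only: X_def inc_def) (simp add: add_ac)
qed simp

lemma standard_BM_backward:
  "standard_BM (\<lambda>t \<omega>. X (of_int (stop n (z \<omega>)) - t) \<omega> - X (of_int (stop n (z \<omega>))) \<omega>)"
proof (rule standard_BM_dyadicI[OF _ _ _ noise_backward[of _ n]])
  have T: "(\<lambda>\<omega>. stop n (z \<omega>)) \<in> M \<rightarrow>\<^sub>M count_space UNIV"
    by (rule measurable_compose[OF z_measurable measurable_stop])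
  show "(\<lambda>\<omega>. X (of_int (stop n (z \<omega>)) - t) \<omega> - X (of_int (stop n (z \<omega>))) \<omega>) \<in> borel_measurable M" for t
    using X_shift_measurable[OF T, of "- t"] X_shift_measurable[OF T, of 0] by simp
  show "AE \<omega> in M. continuous_on {0..} (\<lambda>t. X (of_int (stop n (z \<omega>)) - t) \<omega> - X (of_int (stop n (z \<omega>))) \<omega>)"
    using AE_continuous
  proof eventually_elim
    case (elim \<omega>)
    have "continuous_on {0..} (\<lambda>t. X (of_int (stop n (z \<omega>)) - t) \<omega>)"
      by (rule continuous_on_compose2[OF elim]) (auto intro: continuous_on_add continuous_on_diff continuous_on_const continuous_on_id)
    then show ?case by (intro continuous_on_diff continuous_on_const)
  qed
  fix N k \<omega>
  have "real_of_int (stop n (z \<omega>)) - real j / 2 ^ N = of_int (2 ^ N * stop n (z \<omega>) - int j) / 2 ^ N" for j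
    by (simp add: diff_divide_distrib)
  then show "X (of_int (stop n (z \<omega>)) - real (Suc k) / 2 ^ N) \<omega> - X (of_int (stop n (z \<omega>))) \<omega> -
    (X (of_int (stop n (z \<omega>)) - real k / 2 ^ N) \<omega> - X (of_int (stop n (z \<omega>))) \<omega>)
    = - level N (eta (z \<omega>)) (2 ^ N * stop n (z \<omega>) - 1 - int k) 0 / sqrt (2 ^ N)"
    using trajectory_dyadic_diff[of "eta (z \<omega>)" "2 ^ N * stop n (z \<omega>) - 1 - int k" N]
    by (simp only: X_def inc_def) (simp add: algebra_simps)
qed simp

lemma filterlim_at_bot_int:
  fixes f :: "int \<Rightarrow> real"
  assumes "\<And>n. n \<le> 0 \<Longrightarrow> f n \<le> of_int n"
  shows "filterlim f at_bot at_bot"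
  unfolding filterlim_at_bot eventually_at_bot_linorder
proof
  fix Z :: real
  show "\<exists>N. \<forall>n\<le>N. f n \<le> Z"
    using assms by (intro exI[of _ "min 0 \<lfloor>Z\<rfloor>"]) (force simp: le_floor_iff intro: order_trans)
qed

lemma forward: "forward_BM X"
  unfolding forward_BM_def
proof (intro conjI exI[of _ "\<lambda>n \<omega>. of_int (start (nat (- n)) (z \<omega>))"] allI impI AE_I2)
  show "stochastic_process X" using X_measurable by (simp add: stochastic_process_def)
  show "(\<lambda>\<omega>. real_of_int (start (nat (- n)) (z \<omega>))) \<in> borel_measurable M" for n
    by (rule measurable_compose[OF measurable_compose[OF z_measurable measurable_start]]) simp
  show "filterlim (\<lambda>n. real_of_int (start (nat (- n)) (z \<omega>))) at_bot at_bot" for \<omega>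
  proof (rule filterlim_at_bot_int)
    fix n :: int assume "n \<le> 0"
    then have "start (nat (- n)) (z \<omega>) \<le> n" using start_le[of "nat (- n)" "z \<omega>"] by simp
    then show "real_of_int (start (nat (- n)) (z \<omega>)) \<le> of_int n" by simp
  qed
qed (rule standard_BM_forward)

lemma backward: "backward_BM X"
  unfolding backward_BM_def forward_BM_def
proof (intro conjI exI[of _ "\<lambda>n \<omega>. - of_int (stop (nat (- n)) (z \<omega>))"] allI impI AE_I2)
  show "stochastic_process (\<lambda>t. X (- t))" using X_measurable by (simp add: stochastic_process_def)
  show "(\<lambda>\<omega>. - real_of_int (stop (nat (- n)) (z \<omega>))) \<in> borel_measurable M" for n
    by (rule measurable_compose[OF measurable_compose[OF z_measurable measurable_stop]]) simp
  show "filterlim (\<lambda>n. - real_of_int (stop (nat (- n)) (z \<omega>))) at_bot at_bot" for \<omega>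
  proof (rule filterlim_at_bot_int)
    fix n :: int assume "n \<le> 0"
    then have "- n \<le> stop (nat (- n)) (z \<omega>)" using stop_ge[of "nat (- n)" "z \<omega>"] by simp
    then show "- real_of_int (stop (nat (- n)) (z \<omega>)) \<le> of_int n" by linarith
  qed
  show "standard_BM (\<lambda>t \<omega>. X (- (- real_of_int (stop (nat (- n)) (z \<omega>)) + t)) \<omega> - X (- (- real_of_int (stop (nat (- n)) (z \<omega>)))) \<omega>)" for n
    using standard_BM_backward[of "nat (- n)"] by simp
qed

end

section \<open>Not a two-sided Brownian motion\<close>

lemma (in prob_space) standard_BM_increment:
  "standard_BM B \<Longrightarrow> 0 \<le> s \<Longrightarrow> s < t \<Longrightarrow>
     distributed M lborel (\<lambda>\<omega>. B t \<omega> - B s \<omega>) (normal_density 0 (sqrt (t - s)))"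
  by (simp add: standard_BM_def)

lemma (in prob_space) standard_BM_indep:
  "standard_BM B \<Longrightarrow> 0 \<le> t 0 \<Longrightarrow> mono_on {..n} t \<Longrightarrow>
     indep_vars (\<lambda>_. borel) (\<lambda>i \<omega>. B (t (Suc i)) \<omega> - B (t i) \<omega>) {..<n}" for t :: "nat \<Rightarrow> real"
  by (simp add: standard_BM_def)

text \<open>Chaining along the dyadic subdivisions of the window. Off \<open>E\<close> the
  increments of level \<open>N\<close> are at most \<open>C * (9/10) ^ N\<close>, which sum to
  \<open>10 * C\<close>. The event \<open>E\<close> involves countably many times only, so no
  supremum over an interval has to be measured. The constant 15 is the 3 of the tail bound times the
  bound 5 for the sum of the powers of \<open>q\<close>.\<close>

lemma (in prob_space) standard_BM_oscillation:
  assumes B: "standard_BM B" and t: "0 \<le> t" and L: "0 < L" and C: "0 < C"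
  obtains E where "E \<in> events" "prob E \<le> 15 * L\<^sup>2 / C ^ 4"
    "AE \<omega> in M. \<omega> \<notin> E \<longrightarrow> (\<forall>s\<in>{0..L}. \<bar>B (t + s) \<omega> - B t \<omega>\<bar> \<le> 10 * C)"
proof -
  define u where "u N k = t + real k * L / 2 ^ N" for N k :: nat
  have u0: "0 \<le> u N k" for N k using t L by (simp add: u_def)
  have uS: "u N (Suc k) - u N k = L / 2 ^ N" for N k
    by (simp add: u_def field_simps)
  then have ult: "u N k < u N (Suc k)" for N k
    using L by (metis diff_gt_0_iff_gt zero_less_divide_iff zero_less_numeral zero_less_power)
  define A where "A N k = {\<omega>\<in>space M. C * (9/10) ^ N < \<bar>B (u N (Suc k)) \<omega> - B (u N k) \<omega>\<bar>}" for N k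
  define E where "E = (\<Union>N. \<Union>k<2 ^ N. A N k)"
  have meas: "B v \<in> borel_measurable M" if "0 \<le> v" for v
    using B that by (simp add: standard_BM_def)
  have A: "A N k \<in> events" for N k
  proof -
    have "(\<lambda>\<omega>. B (u N (Suc k)) \<omega> - B (u N k) \<omega>) \<in> borel_measurable M"
      by (intro borel_measurable_diff meas u0)
    then show ?thesis unfolding A_def by measurable
  qed
  have E: "E \<in> events" unfolding E_def using A by auto
  define q :: real where "q = 1 / (2 * (9/10) ^ 4)"
  have q: "0 < q" "q < 1" "1 / (1 - q) \<le> 5" by (simp_all add: q_def power4_eq_xxxx)
  have pA: "prob (A N k) \<le> 3 * L\<^sup>2 / C ^ 4 * (q / 2) ^ N" for N k
  proof -
    have D: "distributed M lborel (\<lambda>\<omega>. B (u N (Suc k)) \<omega> - B (u N k) \<omega>) (normal_density 0 (sqrt (L / 2 ^ N)))"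
      using standard_BM_increment[OF B u0 ult, of N k] by (simp add: uS)
    have "prob (A N k) \<le> 3 * (sqrt (L / 2 ^ N)) ^ 4 / (C * (9/10) ^ N) ^ 4"
      unfolding A_def by (rule normal_tail[OF D]) (use L C in auto)
    also have "(sqrt (L / 2 ^ N)) ^ 4 = L\<^sup>2 / 4 ^ N"
    proof -
      have "(sqrt (L / 2 ^ N)) ^ 4 = (sqrt (L / 2 ^ N) * sqrt (L / 2 ^ N)) * (sqrt (L / 2 ^ N) * sqrt (L / 2 ^ N))"
        by (simp only: power4_eq_xxxx mult.assoc)
      also have "\<dots> = (L / 2 ^ N) * (L / 2 ^ N)" using L by simp
      also have "\<dots> = L\<^sup>2 / (2 ^ N * 2 ^ N)" by (simp add: power2_eq_square)
      also have "(2::real) ^ N * 2 ^ N = 4 ^ N" by (simp flip: power_mult_distrib)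
      finally show ?thesis .
    qed
    also have "(C * (9/10) ^ N) ^ 4 = C ^ 4 * ((9/10) ^ 4) ^ N"
      by (simp only: power_mult_distrib power_mult[symmetric] mult.commute)
    also have "3 * (L\<^sup>2 / 4 ^ N) / (C ^ 4 * ((9/10) ^ 4) ^ N) = 3 * L\<^sup>2 / C ^ 4 * (1 / (4 * (9/10) ^ 4)) ^ N"
    proof -
      have "3 * (L\<^sup>2 / 4 ^ N) / (C ^ 4 * r ^ N) = 3 * L\<^sup>2 / C ^ 4 * (1 / (4 * r)) ^ N" for r
        by (simp add: power_mult_distrib power_divide)
      then show ?thesis .
    qed
    also have "1 / (4 * (9/10) ^ 4) = q / 2" by (simp add: q_def)
    finally show ?thesis .
  qed
  have pU: "prob (\<Union>k<2 ^ N. A N k) \<le> 3 * L\<^sup>2 / C ^ 4 * q ^ N" for N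
  proof -
    have "prob (\<Union>k<2 ^ N. A N k) \<le> (\<Sum>k<2 ^ N. prob (A N k))"
      using A by (intro finite_measure_subadditive_finite) auto
    also have "\<dots> \<le> (\<Sum>k<2 ^ N::nat. 3 * L\<^sup>2 / C ^ 4 * (q / 2) ^ N)" by (intro sum_mono pA)
    also have "\<dots> = 3 * L\<^sup>2 / C ^ 4 * q ^ N" by (simp add: power_divide)
    finally show ?thesis .
  qed
  have sg: "(\<lambda>N. 3 * L\<^sup>2 / C ^ 4 * q ^ N) sums (3 * L\<^sup>2 / C ^ 4 * (1 / (1 - q)))"
    using q by (intro sums_mult geometric_sums) auto
  have sp: "summable (\<lambda>N. prob (\<Union>k<2 ^ N. A N k))"
    by (rule summable_comparison_test'[OF sums_summable[OF sg]]) (use pU in auto)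
  have "prob E \<le> (\<Sum>N. prob (\<Union>k<2 ^ N. A N k))"
    unfolding E_def using A sp by (intro finite_measure_subadditive_countably) auto
  also have "\<dots> \<le> (\<Sum>N. 3 * L\<^sup>2 / C ^ 4 * q ^ N)"
    by (intro suminf_le pU sp sums_summable[OF sg])
  also have "\<dots> = 3 * L\<^sup>2 / C ^ 4 * (1 / (1 - q))" using sg by (simp add: sums_iff)
  also have "\<dots> \<le> 3 * L\<^sup>2 / C ^ 4 * 5" using q by (intro mult_left_mono) auto
  finally have pE: "prob E \<le> 15 * L\<^sup>2 / C ^ 4" by simp
  have "AE \<omega> in M. continuous_on {0..} (\<lambda>t. B t \<omega>)" using B by (simp add: standard_BM_def)
  then have "AE \<omega> in M. \<omega> \<notin> E \<longrightarrow> (\<forall>s\<in>{0..L}. \<bar>B (t + s) \<omega> - B t \<omega>\<bar> \<le> 10 * C)"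
    using AE_space
  proof eventually_elim
    case (elim \<omega>)
    show ?case
    proof (intro impI ballI)
      fix s assume nE: "\<omega> \<notin> E" and s: "s \<in> {0..L}"
      have inc: "\<bar>B (u N (Suc k)) \<omega> - B (u N k) \<omega>\<bar> \<le> C * (9/10) ^ N" if "k < 2 ^ N" for N k
        using nE that elim(2) by (auto simp: E_def A_def not_less)
      show "\<bar>B (t + s) \<omega> - B t \<omega>\<bar> \<le> 10 * C"
      \<comment> \<open>At \<open>s = L\<close> the rounded index would be \<open>2 ^ N\<close>,
        outside the range that \<open>E\<close> controls; there the single increment of level 0 is
        enough.\<close>
      proof (cases "s = L")
        case True
        then show ?thesis using inc[of 0 0] C by (simp add: u_def)
      next
        case False
        then have s': "0 \<le> s / L" "s / L < 1" using s L by auto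
        define j where "j N = nat \<lfloor>s / L * 2 ^ N\<rfloor>" for N
        define x where "x N = B (u N (j N)) \<omega>" for N
        have jlt: "j N < 2 ^ N" for N
        proof -
          have "s / L * 2 ^ N < 2 ^ N" using mult_strict_right_mono[OF s'(2), of "2 ^ N"] by simp
          then have "\<lfloor>s / L * 2 ^ N\<rfloor> < 2 ^ N" by (simp add: floor_less_iff)
          then show ?thesis using s' by (simp add: j_def nat_less_iff)
        qed
        have "\<bar>x (Suc N) - x N\<bar> \<le> C * (9/10) ^ N" for N
        proof -
          have e: "s / L * 2 ^ Suc N = 2 * (s / L * 2 ^ N)" by simp
          have "0 \<le> s / L * 2 ^ N" by (intro mult_nonneg_nonneg s') simp
          then have "0 \<le> \<lfloor>s / L * 2 ^ N\<rfloor>" by (simp only: zero_le_floor)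
          then have "j (Suc N) = 2 * j N \<or> j (Suc N) = Suc (2 * j N)"
            using floor_double[of "s / L * 2 ^ N"] unfolding j_def e by linarith
          moreover have "u N (j N) = u (Suc N) (2 * j N)" by (simp add: u_def)
          moreover have "\<bar>B (u (Suc N) (Suc (2 * j N))) \<omega> - B (u (Suc N) (2 * j N)) \<omega>\<bar> \<le> C * (9/10) ^ Suc N"
            by (rule inc) (use jlt[of N] in simp)
          moreover have "C * (9/10) ^ Suc N \<le> C * (9/10) ^ N" using C by simp
          moreover have "0 \<le> C * (9/10) ^ N" using C by simp
          ultimately show ?thesis unfolding x_def by fastforce
        qed
        then have "\<bar>lim x - x 0\<bar> \<le> 10 * C * (9/10) ^ 0"
          by (intro geometric_limit(2)[of 0]) auto
        moreover have "x 0 = B t \<omega>" using jlt[of 0] by (simp add: x_def u_def)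
        moreover have "lim x = B (t + s) \<omega>"
        proof (rule limI)
          have "(\<lambda>N. t + (real (j N) / 2 ^ N) * L) \<longlonglongrightarrow> t + s / L * L"
            unfolding j_def by (intro tendsto_intros dyadic_floor_tendsto s')
          then have "(\<lambda>N. u N (j N)) \<longlonglongrightarrow> t + s" using L by (simp add: u_def)
          then show "x \<longlonglongrightarrow> B (t + s) \<omega>"
            unfolding x_def using t s u0 by (intro continuous_on_tendsto_compose[OF elim(1)]) auto
        qed
        ultimately show ?thesis by simp
      qed
    qed
  qed
  then show thesis using that E pE by blast
qed

lemma std_normal_open_positive:
  assumes "a < b" "{a<..<b} \<subseteq> A" "A \<in> sets borel"
  shows "0 < measure std_normal_distribution A"
proof (rule ccontr)
  interpret N: prob_space std_normal_distribution by (rule prob_space_std_normal)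
  assume "\<not> 0 < measure std_normal_distribution A"
  then have "emeasure std_normal_distribution A = 0"
    by (simp add: N.emeasure_eq_measure not_less measure_le_0_iff)
  then have "A \<in> null_sets std_normal_distribution" using assms by auto
  then have "AE x in lborel. x \<in> A \<longrightarrow> ennreal (std_normal_density x) = 0"
    by (subst (asm) null_sets_density_iff) auto
  then have "AE x in lborel. x \<notin> A"
    by eventually_elim (use normal_density_pos[of 1 0] in \<open>auto simp: ennreal_eq_0_iff not_le[symmetric]\<close>)
  then have "A \<in> null_sets lborel" using assms by (subst (asm) AE_iff_null_sets[symmetric]) auto
  then have "{a<..<b} \<in> null_sets lborel" by (rule null_sets_subset) (use assms in auto)
  then show False using assms by (auto simp: null_sets_def)
qed

lemma (in prob_space) standard_BM_two_increments:
  assumes B: "standard_BM B" and a: "0 < a" and U: "U \<in> sets borel" "V \<in> sets borel"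
  shows "prob {\<omega>\<in>space M. (B a \<omega> - B 0 \<omega>) / sqrt a \<in> U \<and> (B (2 * a) \<omega> - B a \<omega>) / sqrt a \<in> V}
    = measure std_normal_distribution U * measure std_normal_distribution V"
proof -
  define D where "D i \<omega> = B (real (Suc i) * a) \<omega> - B (real i * a) \<omega>" for i \<omega>
  have ind: "indep_vars (\<lambda>_. borel) D {..<2}"
  proof -
    have "mono_on {..2} (\<lambda>i. real i * a)" using a by (auto simp: mono_on_def)
    from standard_BM_indep[OF B _ this] show ?thesis by (simp add: D_def[abs_def])
  qed
  have nD: "prob (D i -` ((\<lambda>x. x / sqrt a) -` W) \<inter> space M) = measure std_normal_distribution W"
    if W: "W \<in> sets borel" for i W
  proof -
    have "distributed M lborel (D i) (normal_density 0 (sqrt a))"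
    proof -
      have "real (Suc i) * a - real i * a = a" by (simp add: algebra_simps)
      moreover have "0 \<le> real i * a" "real i * a < real (Suc i) * a" using a by (auto simp: algebra_simps)
      ultimately show ?thesis
        using standard_BM_increment[OF B, of "real i * a" "real (Suc i) * a"] by (simp only: D_def[abs_def])
    qed
    then have d: "distributed M lborel (\<lambda>\<omega>. D i \<omega> / sqrt a) std_normal_density"
      using a by (subst (asm) normal_standard_normal_convert) auto
    have "measure std_normal_distribution W = measure (distr M lborel (\<lambda>\<omega>. D i \<omega> / sqrt a)) W"
      using distributed_distr_eq_density[OF d] by simp
    also have "\<dots> = prob ((\<lambda>\<omega>. D i \<omega> / sqrt a) -` W \<inter> space M)"
      using distributed_measurable[OF d] W by (intro measure_distr) auto
    finally show ?thesis by (simp add: vimage_def)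
  qed
  define W where "W i = (\<lambda>x. x / sqrt a) -` (if i = (0::nat) then U else V)" for i
  have W: "W i \<in> sets borel" for i
    unfolding W_def using U by (intro measurable_sets_borel[of "\<lambda>x. x / sqrt a"]) auto
  have "prob (\<Inter>i\<in>{..<2}. D i -` W i \<inter> space M) = (\<Prod>i\<in>{..<2}. prob (D i -` W i \<inter> space M))"
    using W by (intro indep_varsD[OF ind]) (auto simp: lessThan_empty_iff)
  also have "\<dots> = measure std_normal_distribution U * measure std_normal_distribution V"
    using nD[OF U(1), of 0] nD[OF U(2), of 1] by (simp add: numeral_2_eq_2 lessThan_Suc W_def mult.commute)
  also have "(\<Inter>i\<in>{..<2}. D i -` W i \<inter> space M)
     = {\<omega>\<in>space M. (B a \<omega> - B 0 \<omega>) / sqrt a \<in> U \<and> (B (2 * a) \<omega> - B a \<omega>) / sqrt a \<in> V}"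
    by (auto simp: numeral_2_eq_2 lessThan_Suc W_def D_def)
  finally show ?thesis .
qed

lemma psum_plus: "psum g (k + int b) = psum g k + (\<Sum>i<b. g (k + int i))"
proof (induction b)
  case (Suc b)
  have "psum g (k + int (Suc b)) = psum g ((k + int b) + 1)" by (simp add: algebra_simps)
  then show ?case unfolding psum_plus1 using Suc by simp
qed simp

section \<open>Contradiction with a random time of two-sided Brownian motion\<close>

context noise_source begin

lemma X_int_diff: "X (of_int (k + int b)) \<omega> - X (of_int k) \<omega> = (\<Sum>i<b. eta (z \<omega>) (k + int i) 0)"
  unfolding X_def trajectory_int psum_plus by simp

lemma word_sum:
  assumes "i + b \<le> len N"
  shows "(\<Sum>k<b. word N (z \<omega>) (i + k, 0))
    = X (of_int (start N (z \<omega>) + int i + int b)) \<omega> - X (of_int (start N (z \<omega>) + int i)) \<omega>"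
  unfolding X_int_diff
proof (intro sum.cong refl)
  fix k assume "k \<in> {..<b}"
  then have "eta (z \<omega>) (start N (z \<omega>) + int i + int k) 0 = word N (z \<omega>) (nat (start N (z \<omega>) + int i + int k - start N (z \<omega>)), 0)"
    using assms by (intro eta_eq) (auto simp: stop_def)
  moreover have "nat (start N (z \<omega>) + int i + int k - start N (z \<omega>)) = i + k" by simp
  ultimately show "word N (z \<omega>) (i + k, 0) = eta (z \<omega>) (start N (z \<omega>) + int i + int k) 0" by simp
qed

text \<open>If the signs agree, \<open>U D\<close> precedes \<open>V n\<close>, so \<open>U\<close>
  is the farther left block and \<open>U'\<close> the nearer right one. If they differ,
  \<open>D\<close> stands to the right of \<open>V n\<close>, so \<open>U\<close> is the nearer left
  block and \<open>U'\<close> the farther right one. Not knowing which case occurred leaves a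
  disjunction, valid for every sample.\<close>

lemma block_relation:
  defines "s n \<omega> \<equiv> real_of_int (start n (z \<omega>))" and "e n \<omega> \<equiv> real_of_int (stop n (z \<omega>))"
    and "a n \<equiv> real (blk n)"
  shows "(0 < X (s n \<omega> - a n) \<omega> - X (s n \<omega> - 2 * a n) \<omega>) = (0 < X (e n \<omega> + a n) \<omega> - X (e n \<omega>) \<omega>)
    \<or> (0 < X (s n \<omega>) \<omega> - X (s n \<omega> - a n) \<omega>) \<noteq> (0 < X (e n \<omega> + 2 * a n) \<omega> - X (e n \<omega> + a n) \<omega>)"
proof -
  define c where "c = coin n (word n (z \<omega>))"
  let ?w = "word (Suc n) (z \<omega>)"
  have "agree n ?w = c" by (simp add: agree_word c_def)
  moreover have "block_positive 0 (blk n) ?w = (0 < X (of_int (start (Suc n) (z \<omega>)) + a n) \<omega> - X (of_int (start (Suc n) (z \<omega>))) \<omega>)"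
    using word_sum[of 0 "blk n" "Suc n" \<omega>] by (simp add: block_positive_def len_Suc a_def)
  moreover have "block_positive (len n + 2 * blk n) (blk n) ?w = (0 < X (of_int (stop (Suc n) (z \<omega>))) \<omega> - X (of_int (stop (Suc n) (z \<omega>)) - a n) \<omega>)"
  proof -
    have "real_of_int (start (Suc n) (z \<omega>) + int (len n + 2 * blk n) + int (blk n)) = of_int (stop (Suc n) (z \<omega>))"
      "real_of_int (start (Suc n) (z \<omega>) + int (len n + 2 * blk n)) = of_int (stop (Suc n) (z \<omega>)) - a n"
      by (simp_all add: stop_def len_Suc a_def)
    then show ?thesis
      using word_sum[of "len n + 2 * blk n" "blk n" "Suc n" \<omega>] by (simp only: block_positive_def len_Suc)
  qed
  ultimately have rel: "((0 < X (of_int (start (Suc n) (z \<omega>)) + a n) \<omega> - X (of_int (start (Suc n) (z \<omega>))) \<omega>)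
    = (0 < X (of_int (stop (Suc n) (z \<omega>))) \<omega> - X (of_int (stop (Suc n) (z \<omega>)) - a n) \<omega>)) = c"
    by (simp add: agree_def)
  have "left n (z \<omega>) = (if c then 2 * blk n else blk n)" by (simp add: left_def offset_def c_def)
  then have ends: "real_of_int (start (Suc n) (z \<omega>)) = s n \<omega> - (if c then 2 * a n else a n)"
    "real_of_int (stop (Suc n) (z \<omega>)) = e n \<omega> + (if c then a n else 2 * a n)"
    by (simp_all add: start.simps(2) stop_Suc s_def e_def a_def)
  have "x - 2 * a n + a n = x - a n" "x + 2 * a n - a n = x + a n" for x by simp_all
  then show ?thesis
    using rel unfolding ends by (cases c) (simp_all add: add.commute)
qed

lemma start_stop_bounds: "- int (len n) \<le> start n y" "start n y \<le> 0" "0 \<le> stop n y" "stop n y \<le> int (len n)"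
  using start_le[of n y] stop_ge[of n y] by (auto simp: stop_def)


lemma not_two_sided: "\<not> two_sided_BM X"
proof
  assume "two_sided_BM X"
  then obtain S where S: "S \<in> borel_measurable M"
    and P: "standard_BM (\<lambda>t \<omega>. X (S \<omega> + t) \<omega> - X (S \<omega>) \<omega>)"
    and Q: "standard_BM (\<lambda>t \<omega>. X (S \<omega> - t) \<omega> - X (S \<omega>) \<omega>)"
    and PQ: "indep_processes (\<lambda>t \<omega>. X (S \<omega> + t) \<omega> - X (S \<omega>) \<omega>) (\<lambda>t \<omega>. X (S \<omega> - t) \<omega> - X (S \<omega>) \<omega>)"
    unfolding two_sided_BM_def by auto
  define Yp where "Yp t \<omega> = X (S \<omega> + t) \<omega> - X (S \<omega>) \<omega>" for t \<omega>
  define Ym where "Ym t \<omega> = X (S \<omega> - t) \<omega> - X (S \<omega>) \<omega>" for t \<omega>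
  have Yp: "standard_BM Yp" and Ym: "standard_BM Ym" and ind: "indep_processes Yp Ym"
    using P Q PQ by (simp_all add: Yp_def[abs_def] Ym_def[abs_def])
  have [simp]: "Yp 0 \<omega> = 0" "Ym 0 \<omega> = 0" for \<omega> by (simp_all add: Yp_def Ym_def)
  \<comment> \<open>The pattern violating both relations: both right increments are positive, the
    nearer left one is positive, the farther left one is negative. \<open>Ym\<close> runs leftwards,
    which turns the left signs round, hence \<open>V\<close> and then \<open>U\<close>. Requiring
    more than one standard deviation leaves room for displaced endpoints.\<close>
  define U where "U = ({1<..} :: real set)"
  define V where "V = ({..<-1} :: real set)"
  define c where "c = measure std_normal_distribution U * measure std_normal_distribution U
    * (measure std_normal_distribution V * measure std_normal_distribution U)"
  have UV[measurable]: "U \<in> sets borel" "V \<in> sets borel" by (simp_all add: U_def V_def)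
  have c: "0 < c"
    unfolding c_def by (intro mult_pos_pos; rule std_normal_open_positive[of 1 2] std_normal_open_positive[of "-2" "-1"])
      (auto simp: U_def V_def)
  \<comment> \<open>Up to an error that vanishes with \<open>n\<close>, the pattern is impossible;
    its probability \<open>c\<close> does not depend on \<open>n\<close>. The factor 6 counts the
    windows around \<open>0\<close>, \<open>a\<close> and \<open>2 * a\<close> on the two sides of
    \<open>S\<close>.\<close>
  have bound: "c \<le> prob {\<omega>\<in>space M. real n < \<bar>S \<omega>\<bar>} + 6 * (15 * 8 ^ 4 / (real n + 1)\<^sup>2)" for n
  proof -
    define m where "m = len n"
    \<comment> \<open>For \<open>\<bar>S\<bar>\<close> at most \<open>n\<close>, the ends of
      \<open>V n\<close> are within \<open>n + m\<close> of \<open>S\<close>. So \<open>K\<close>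
      bounds the displacement, and the block length is the square of \<open>16 * K\<close>.\<close>
    define K where "K = real n + real m + 1"
    define a where "a = real (blk n)"
    \<comment> \<open>This makes the oscillation \<open>20 * C\<close> over a window equal to
      \<open>5 * K\<close>. Moving both endpoints of an increment then costs at most
      \<open>10 * K\<close>, less than its size \<open>16 * K\<close>, while the exceptional
      probability is still of order \<open>1 / K ^ 2\<close>.\<close>
    define C where "C = K / 4"
    have a: "a = (16 * K)\<^sup>2" by (simp add: a_def blk_def block_def K_def m_def)
    have K: "1 \<le> K" "0 < K" by (simp_all add: K_def)
    have sa: "sqrt a = 16 * K" "0 < a" using K a by (auto intro: real_sqrt_unique)
    have aK: "K \<le> a" using K by (simp add: a power2_eq_square)
    have C: "0 < C" using K by (simp add: C_def)
    have bd: "15 * (2 * K)\<^sup>2 / C ^ 4 \<le> 15 * 8 ^ 4 / (real n + 1)\<^sup>2"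
    proof -
      have "15 * (2 * K)\<^sup>2 / C ^ 4 = 15 * (4 * 4 ^ 4) / K\<^sup>2"
        using K by (simp add: C_def power_divide power4_eq_xxxx power2_eq_square)
      also have "\<dots> \<le> 15 * 8 ^ 4 / (real n + 1)\<^sup>2"
        using K by (intro frac_le power_mono) (auto simp: K_def)
      finally show ?thesis .
    qed
    have win: "\<exists>E. E \<in> events \<and> prob E \<le> 15 * 8 ^ 4 / (real n + 1)\<^sup>2 \<and>
      (AE \<omega> in M. \<omega> \<notin> E \<longrightarrow> (\<forall>v\<in>{t..t + 2 * K}. \<forall>v'\<in>{t..t + 2 * K}. \<bar>B v \<omega> - B v' \<omega>\<bar> \<le> 20 * C))"
      if B: "standard_BM B" and t: "0 \<le> t" for B t
    proof -
      obtain E where E: "E \<in> events" "prob E \<le> 15 * (2 * K)\<^sup>2 / C ^ 4"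
        "AE \<omega> in M. \<omega> \<notin> E \<longrightarrow> (\<forall>s\<in>{0..2 * K}. \<bar>B (t + s) \<omega> - B t \<omega>\<bar> \<le> 10 * C)"
        using standard_BM_oscillation[OF B t _ C, of "2 * K"] K by auto
      have "AE \<omega> in M. \<omega> \<notin> E \<longrightarrow> (\<forall>v\<in>{t..t + 2 * K}. \<forall>v'\<in>{t..t + 2 * K}. \<bar>B v \<omega> - B v' \<omega>\<bar> \<le> 20 * C)"
        using E(3)
      proof eventually_elim
        case (elim \<omega>)
        show ?case
        proof (intro impI ballI)
          fix v v' assume nE: "\<omega> \<notin> E" and v: "v \<in> {t..t + 2 * K}" "v' \<in> {t..t + 2 * K}"
          have "v - t \<in> {0..2 * K}" "v' - t \<in> {0..2 * K}" using v by auto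
          then have "\<bar>B (t + (v - t)) \<omega> - B t \<omega>\<bar> \<le> 10 * C" "\<bar>B (t + (v' - t)) \<omega> - B t \<omega>\<bar> \<le> 10 * C"
            using elim nE by blast+
          then show "\<bar>B v \<omega> - B v' \<omega>\<bar> \<le> 20 * C" by simp
        qed
      qed
      then show ?thesis using E bd by (intro exI[of _ E]) auto
    qed
    have nn: "0 \<le> a - K" "0 \<le> 2 * a - K" using aK K by auto
    obtain E1 where E1: "E1 \<in> events" "prob E1 \<le> 15 * 8 ^ 4 / (real n + 1)\<^sup>2"
      "AE \<omega> in M. \<omega> \<notin> E1 \<longrightarrow> (\<forall>v\<in>{0..0 + 2 * K}. \<forall>v'\<in>{0..0 + 2 * K}. \<bar>Yp v \<omega> - Yp v' \<omega>\<bar> \<le> 20 * C)"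
      using win[OF Yp order_refl] by blast
    obtain E2 where E2: "E2 \<in> events" "prob E2 \<le> 15 * 8 ^ 4 / (real n + 1)\<^sup>2"
      "AE \<omega> in M. \<omega> \<notin> E2 \<longrightarrow> (\<forall>v\<in>{a-K..a-K + 2 * K}. \<forall>v'\<in>{a-K..a-K + 2 * K}. \<bar>Yp v \<omega> - Yp v' \<omega>\<bar> \<le> 20 * C)"
      using win[OF Yp nn(1)] by blast
    obtain E3 where E3: "E3 \<in> events" "prob E3 \<le> 15 * 8 ^ 4 / (real n + 1)\<^sup>2"
      "AE \<omega> in M. \<omega> \<notin> E3 \<longrightarrow> (\<forall>v\<in>{2*a-K..2*a-K + 2 * K}. \<forall>v'\<in>{2*a-K..2*a-K + 2 * K}. \<bar>Yp v \<omega> - Yp v' \<omega>\<bar> \<le> 20 * C)"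
      using win[OF Yp nn(2)] by blast
    obtain E4 where E4: "E4 \<in> events" "prob E4 \<le> 15 * 8 ^ 4 / (real n + 1)\<^sup>2"
      "AE \<omega> in M. \<omega> \<notin> E4 \<longrightarrow> (\<forall>v\<in>{0..0 + 2 * K}. \<forall>v'\<in>{0..0 + 2 * K}. \<bar>Ym v \<omega> - Ym v' \<omega>\<bar> \<le> 20 * C)"
      using win[OF Ym order_refl] by blast
    obtain E5 where E5: "E5 \<in> events" "prob E5 \<le> 15 * 8 ^ 4 / (real n + 1)\<^sup>2"
      "AE \<omega> in M. \<omega> \<notin> E5 \<longrightarrow> (\<forall>v\<in>{a-K..a-K + 2 * K}. \<forall>v'\<in>{a-K..a-K + 2 * K}. \<bar>Ym v \<omega> - Ym v' \<omega>\<bar> \<le> 20 * C)"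
      using win[OF Ym nn(1)] by blast
    obtain E6 where E6: "E6 \<in> events" "prob E6 \<le> 15 * 8 ^ 4 / (real n + 1)\<^sup>2"
      "AE \<omega> in M. \<omega> \<notin> E6 \<longrightarrow> (\<forall>v\<in>{2*a-K..2*a-K + 2 * K}. \<forall>v'\<in>{2*a-K..2*a-K + 2 * K}. \<bar>Ym v \<omega> - Ym v' \<omega>\<bar> \<le> 20 * C)"
      using win[OF Ym nn(2)] by blast
    define D where "D = {\<omega>\<in>space M. real n < \<bar>S \<omega>\<bar>}"
    have D: "D \<in> events" unfolding D_def using S by measurable
    define Gp where "Gp = {\<omega>\<in>space M. (Yp a \<omega> - Yp 0 \<omega>) / sqrt a \<in> U \<and> (Yp (2 * a) \<omega> - Yp a \<omega>) / sqrt a \<in> U}"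
    define Gm where "Gm = {\<omega>\<in>space M. (Ym a \<omega> - Ym 0 \<omega>) / sqrt a \<in> V \<and> (Ym (2 * a) \<omega> - Ym a \<omega>) / sqrt a \<in> U}"
    have G: "prob (Gp \<inter> Gm) = c"
    proof -
      let ?PM = "Pi\<^sub>M {0..} (\<lambda>_. borel) :: (real \<Rightarrow> real) measure"
      define W where "W T = {f\<in>space ?PM. (f a - f 0) / sqrt a \<in> T \<and> (f (2 * a) - f a) / sqrt a \<in> U}" for T
      have cm[measurable]: "(\<lambda>f. f v) \<in> borel_measurable ?PM" if "0 \<le> v" for v
        using that by (intro measurable_component_singleton) auto
      have W: "W T \<in> sets ?PM" if [measurable]: "T \<in> sets borel" for T
      proof -
        have [measurable]: "(\<lambda>f. f a) \<in> borel_measurable ?PM" "(\<lambda>f. f 0) \<in> borel_measurable ?PM" "(\<lambda>f. f (2 * a)) \<in> borel_measurable ?PM"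
          using sa by (auto intro!: cm)
        show ?thesis unfolding W_def by measurable
      qed
      have "prob ((\<lambda>\<omega>. (\<lambda>t\<in>{0..}. Yp t \<omega>, \<lambda>t\<in>{0..}. Ym t \<omega>)) -` (W U \<times> W V) \<inter> space M)
        = prob ((\<lambda>\<omega>. \<lambda>t\<in>{0..}. Yp t \<omega>) -` W U \<inter> space M) * prob ((\<lambda>\<omega>. \<lambda>t\<in>{0..}. Ym t \<omega>) -` W V \<inter> space M)"
        by (rule indep_varD[OF ind[unfolded indep_processes_def] W W]) (rule UV)+
      also have "(\<lambda>\<omega>. \<lambda>t\<in>{0..}. Yp t \<omega>) -` W U \<inter> space M = Gp"
        using sa by (auto simp: W_def Gp_def space_PiM)
      also have "(\<lambda>\<omega>. \<lambda>t\<in>{0..}. Ym t \<omega>) -` W V \<inter> space M = Gm"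
        using sa by (auto simp: W_def Gm_def space_PiM)
      also have "(\<lambda>\<omega>. (\<lambda>t\<in>{0..}. Yp t \<omega>, \<lambda>t\<in>{0..}. Ym t \<omega>)) -` (W U \<times> W V) \<inter> space M = Gp \<inter> Gm"
        using sa by (auto simp: W_def Gp_def Gm_def space_PiM)
      also have "prob Gp = measure std_normal_distribution U * measure std_normal_distribution U"
        unfolding Gp_def by (rule standard_BM_two_increments[OF Yp sa(2) UV(1) UV(1)])
      also have "prob Gm = measure std_normal_distribution V * measure std_normal_distribution U"
        unfolding Gm_def by (rule standard_BM_two_increments[OF Ym sa(2) UV(2) UV(1)])
      finally show ?thesis by (simp add: c_def)
    qed
    let ?E = "D \<union> E1 \<union> E2 \<union> E3 \<union> E4 \<union> E5 \<union> E6"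
    \<comment> \<open>Outside the exceptional events the pattern at \<open>S\<close> carries over to
      the ends of \<open>V n\<close>, where \<open>block_relation\<close> forbids it.\<close>
    have "AE \<omega> in M. \<omega> \<in> Gp \<inter> Gm \<longrightarrow> \<omega> \<in> ?E"
      using E1(3) E2(3) E3(3) E4(3) E5(3) E6(3) AE_space
    proof eventually_elim
      case (elim \<omega>)
      show ?case
      proof (rule impI, rule ccontr)
        assume g: "\<omega> \<in> Gp \<inter> Gm" and n: "\<omega> \<notin> ?E"
        have g4: "16 * K < Yp a \<omega>" "16 * K < Yp (2 * a) \<omega> - Yp a \<omega>" "Ym a \<omega> < - 16 * K" "16 * K < Ym (2 * a) \<omega> - Ym a \<omega>"
          using g K sa by (auto simp: Gp_def Gm_def U_def V_def pos_less_divide_eq pos_divide_less_eq)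
        define s where "s = real_of_int (start n (z \<omega>))"
        define e where "e = real_of_int (stop n (z \<omega>))"
        have "\<bar>S \<omega>\<bar> \<le> real n" using n elim by (auto simp: D_def not_less)
        moreover have "- real m \<le> s" "s \<le> 0" "0 \<le> e" "e \<le> real m"
          using start_stop_bounds[of n "z \<omega>"] unfolding s_def e_def m_def by linarith+
        ultimately have se: "\<bar>s - S \<omega>\<bar> \<le> K" "\<bar>e - S \<omega>\<bar> \<le> K" by (auto simp: K_def)
        \<comment> \<open>The ends of \<open>V n\<close> may lie on either side of \<open>S\<close>,
          so both one-sided paths are needed near 0.\<close>
        have near: "\<bar>X (S \<omega> + h) \<omega> - X (S \<omega>) \<omega>\<bar> \<le> 5 * K" if "\<bar>h\<bar> \<le> K" for h
        proof (cases "0 \<le> h")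
          case True
          then have "h \<in> {0..0 + 2 * K}" "0 \<in> {0..0 + 2 * K}" using that K by auto
          then have "\<bar>Yp h \<omega> - Yp 0 \<omega>\<bar> \<le> 20 * C" using elim(1) n by blast
          then show ?thesis by (simp add: Yp_def C_def)
        next
          case False
          then have "- h \<in> {0..0 + 2 * K}" "0 \<in> {0..0 + 2 * K}" using that K by auto
          then have "\<bar>Ym (- h) \<omega> - Ym 0 \<omega>\<bar> \<le> 20 * C" using elim(4) n by blast
          then show ?thesis by (simp add: Ym_def C_def)
        qed
        have p1: "\<bar>X (S \<omega> + a + h) \<omega> - X (S \<omega>) \<omega> - Yp a \<omega>\<bar> \<le> 5 * K" if "\<bar>h\<bar> \<le> K" for h
        proof -
          have "a + h \<in> {a-K..a-K + 2 * K}" "a \<in> {a-K..a-K + 2 * K}" using that K by auto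
          then have "\<bar>Yp (a + h) \<omega> - Yp a \<omega>\<bar> \<le> 20 * C" using elim(2) n by blast
          then show ?thesis by (simp add: Yp_def[of "a + h"] C_def add.assoc)
        qed
        have p2: "\<bar>X (S \<omega> + 2 * a + h) \<omega> - X (S \<omega>) \<omega> - Yp (2 * a) \<omega>\<bar> \<le> 5 * K" if "\<bar>h\<bar> \<le> K" for h
        proof -
          have "2 * a + h \<in> {2*a-K..2*a-K + 2 * K}" "2 * a \<in> {2*a-K..2*a-K + 2 * K}" using that K by auto
          then have "\<bar>Yp (2 * a + h) \<omega> - Yp (2 * a) \<omega>\<bar> \<le> 20 * C" using elim(3) n by blast
          then show ?thesis by (simp add: Yp_def[of "2 * a + h"] C_def add.assoc)
        qed
        have m1: "\<bar>X (S \<omega> - a + h) \<omega> - X (S \<omega>) \<omega> - Ym a \<omega>\<bar> \<le> 5 * K" if "\<bar>h\<bar> \<le> K" for h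
        proof -
          have "a - h \<in> {a-K..a-K + 2 * K}" "a \<in> {a-K..a-K + 2 * K}" using that K by auto
          then have "\<bar>Ym (a - h) \<omega> - Ym a \<omega>\<bar> \<le> 20 * C" using elim(5) n by blast
          then show ?thesis unfolding Ym_def[of "a - h"] C_def by (simp add: algebra_simps)
        qed
        have m2: "\<bar>X (S \<omega> - 2 * a + h) \<omega> - X (S \<omega>) \<omega> - Ym (2 * a) \<omega>\<bar> \<le> 5 * K" if "\<bar>h\<bar> \<le> K" for h
        proof -
          have "2 * a - h \<in> {2*a-K..2*a-K + 2 * K}" "2 * a \<in> {2*a-K..2*a-K + 2 * K}" using that K by auto
          then have "\<bar>Ym (2 * a - h) \<omega> - Ym (2 * a) \<omega>\<bar> \<le> 20 * C" using elim(6) n by blast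
          then show ?thesis unfolding Ym_def[of "2 * a - h"] C_def by (simp add: algebra_simps)
        qed
        have "X (s - a) \<omega> - X (s - 2 * a) \<omega> < 0"
          using m1[OF se(1)] m2[OF se(1)] g4(4) K(2) by simp
        moreover have "0 < X (e + a) \<omega> - X e \<omega>"
          using p1[OF se(2)] near[OF se(2)] g4(1) K(2) by (simp add: add.commute)
        moreover have "0 < X s \<omega> - X (s - a) \<omega>"
          using m1[OF se(1)] near[OF se(1)] g4(3) K(2) by simp
        moreover have "0 < X (e + 2 * a) \<omega> - X (e + a) \<omega>"
          using p1[OF se(2)] p2[OF se(2)] g4(2) K(2) by (simp add: add.commute)
        ultimately show False
          using block_relation[where n=n and \<omega>=\<omega>] unfolding s_def e_def a_def by linarith
      qed
    qed
    then have "prob (Gp \<inter> Gm) \<le> prob ?E"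
      using D E1(1) E2(1) E3(1) E4(1) E5(1) E6(1) by (intro finite_measure_mono_AE) auto
    also have "\<dots> \<le> prob D + prob E1 + prob E2 + prob E3 + prob E4 + prob E5 + prob E6"
      using D E1(1) E2(1) E3(1) E4(1) E5(1) E6(1)
      by (intro order_trans[OF measure_Un_le] add_mono order_refl) auto
    finally show ?thesis
      using G E1(2) E2(2) E3(2) E4(2) E5(2) E6(2) by (simp add: D_def)
  qed
  have "(\<lambda>n. prob {\<omega>\<in>space M. real n < \<bar>S \<omega>\<bar>} + 6 * (15 * 8 ^ 4 / (real n + 1)\<^sup>2)) \<longlonglongrightarrow> 0 + 6 * 0"
  proof (intro tendsto_add tendsto_mult tendsto_const)
    have "(\<lambda>n. prob {\<omega>\<in>space M. real n < \<bar>S \<omega>\<bar>}) \<longlonglongrightarrow> prob (\<Inter>n. {\<omega>\<in>space M. real n < \<bar>S \<omega>\<bar>})"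
      using S by (intro finite_Lim_measure_decseq) (auto simp: decseq_def)
    moreover have "(\<Inter>n. {\<omega>\<in>space M. real n < \<bar>S \<omega>\<bar>}) = {}"
    proof -
      have "\<exists>n. \<not> real n < \<bar>S \<omega>\<bar>" for \<omega>
        using reals_Archimedean2[of "\<bar>S \<omega>\<bar>"] by (auto simp: not_less intro: less_imp_le)
      then show ?thesis by auto
    qed
    ultimately show "(\<lambda>n. prob {\<omega>\<in>space M. real n < \<bar>S \<omega>\<bar>}) \<longlonglongrightarrow> 0" by simp
    show "(\<lambda>n. 15 * 8 ^ 4 / (real n + 1)\<^sup>2) \<longlonglongrightarrow> 0"
    proof -
      have "(\<lambda>n. 15 * 8 ^ 4 * (inverse (real (Suc n)))\<^sup>2) \<longlonglongrightarrow> 15 * 8 ^ 4 * 0\<^sup>2"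
        by (intro tendsto_intros LIMSEQ_inverse_real_of_nat)
      then show ?thesis by (simp add: divide_inverse power_inverse add.commute)
    qed
  qed
  \<comment> \<open>Tightness of the real-valued \<open>S\<close> disposes of the first error term,
    and \<open>1 / (n + 1) ^ 2\<close> of the second.\<close>
  then have "c \<le> 0 + 6 * 0" using bound by (intro LIMSEQ_le_const) auto
  then show False using c by simp
qed

end

theorem theorem6p1:
  "\<exists>(M :: (real \<Rightarrow> real) measure) (X :: real \<Rightarrow> (real \<Rightarrow> real) \<Rightarrow> real).
     prob_space M \<and>
     prob_space.forward_BM M X \<and>
     prob_space.backward_BM M X \<and>
     \<not> prob_space.two_sided_BM M X"
proof -
  \<comment> \<open>Countably many coordinates suffice for the noise. They are stored at the natural
    numbers of a function on the reals, and \<open>A\<close> is the sigma-algebra generated by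
    \<open>dec\<close>, so that transporting the product measure along the right inverse
    \<open>enc\<close> turns \<open>dec\<close> into a noise.\<close>
  define dec :: "(real \<Rightarrow> real) \<Rightarrow> nat \<times> nat \<Rightarrow> real" where "dec f p = f (real (to_nat p))" for f p
  define enc :: "(nat \<times> nat \<Rightarrow> real) \<Rightarrow> real \<Rightarrow> real" where "enc y x = y (from_nat (nat \<lfloor>x\<rfloor>))" for y x
  have de: "dec (enc y) = y" for y by (simp add: dec_def enc_def fun_eq_iff)
  define A :: "(real \<Rightarrow> real) measure" where "A = vimage_algebra UNIV dec gauss_space"
  define M where "M = distr gauss_space A enc"
  have enc: "enc \<in> gauss_space \<rightarrow>\<^sub>M A"
    unfolding A_def by (rule measurable_vimage_algebra2) (simp_all add: de)
  have dec: "dec \<in> M \<rightarrow>\<^sub>M gauss_space"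
    unfolding M_def A_def by (simp add: measurable_vimage_algebra1)
  have M: "prob_space M"
    unfolding M_def by (rule prob_space.prob_space_distr[OF prob_space_gauss enc])
  have "distr M gauss_space dec = distr gauss_space gauss_space (dec \<circ> enc)"
    using dec unfolding M_def by (intro distr_distr enc) simp
  also have "\<dots> = gauss_space" by (simp add: comp_def de distr_id2)
  finally have "gauss_noise M dec" using dec by (simp add: gauss_noise_def)
  then interpret noise_source M dec
    using M by (simp add: noise_source_def noise_source_axioms_def)
  show ?thesis
    using M forward backward not_two_sided by blast
qed

end
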